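(* Let $n\geq 1$ and let $q\in\mathbb{K}^*$. If $q$ is not a root of unity then every prime ideal of $L_n^q$ is completely prime.
   Context: $\mathbb{K}$ is an algebraically closed field, $\mathbb{K}^*=\mathbb{K}\setminus\{0\}$. $L_n^q$ is the $\mathbb{K}$-algebra generated by $x_1,\dots,x_n$ subject to the relations: $x_ix_{i+1}-qx_{i+1}x_i=1-q$ for $1\leq i\leq n-1$; $x_ix_j=qx_jx_i$ for $1\leq i$, $i+1<j\leq n$, $j-i$ odd; $x_ix_j=q^{-1}x_jx_i$ for $1\leq i$, $i+1<j\leq n$, $j-i$ even. An ideal $P$ of a ring $R$ is completely prime if $R/P$ is a domain. *)

theory Defs
  imports
    "HOL-Algebra.QuotRing"
    "HOL-Algebra.Ideal_Product"
    "HOL-Computational_Algebra.Polynomial"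
begin

section \<open>Prime and completely prime ideals of noncommutative rings\<close>

text \<open>
  The predicates \<^locale>\<open>primeideal\<close> and \<^locale>\<open>domain\<close> of HOL-Algebra presuppose a
  commutative ring, so the noncommutative notions are defined here. All ideals are two-sided.
\<close>

definition nc_prime_ideal :: "'a set \<Rightarrow> ('a, 'b) ring_scheme \<Rightarrow> bool" where
  "nc_prime_ideal P R \<longleftrightarrow>
     ideal P R \<and> P \<noteq> carrier R \<and>
     (\<forall>I J. ideal I R \<longrightarrow> ideal J R \<longrightarrow> I \<cdot>\<^bsub>R\<^esub> J \<subseteq> P \<longrightarrow> I \<subseteq> P \<or> J \<subseteq> P)"

definition nc_domain :: "('a, 'b) ring_scheme \<Rightarrow> bool" where
  "nc_domain R \<longleftrightarrow>
     ring R \<and> \<one>\<^bsub>R\<^esub> \<noteq> \<zero>\<^bsub>R\<^esub> \<and>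
     (\<forall>a \<in> carrier R. \<forall>b \<in> carrier R.
        a \<otimes>\<^bsub>R\<^esub> b = \<zero>\<^bsub>R\<^esub> \<longrightarrow> a = \<zero>\<^bsub>R\<^esub> \<or> b = \<zero>\<^bsub>R\<^esub>)"

definition completely_prime_ideal :: "'a set \<Rightarrow> ('a, 'b) ring_scheme \<Rightarrow> bool" where
  "completely_prime_ideal P R \<longleftrightarrow> ideal P R \<and> nc_domain (R Quot P)"


section \<open>The free associative algebra\<close>

text \<open>
  An element of the free algebra on \<open>x\<^sub>1, \<dots>, x\<^sub>n\<close> is its coefficient function: a finitely
  supported function on words over \<open>{1..n}\<close>. The product is induced by concatenation of words;
  \<open>take i w\<close> and \<open>drop i w\<close> for \<open>i \<le> length w\<close> are exactly the factorizations of \<open>w\<close>.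
\<close>

definition free_algebra :: "nat \<Rightarrow> (nat list \<Rightarrow> 'k::field) ring" where
  "free_algebra n =
     \<lparr>carrier = {f. finite {w. f w \<noteq> 0} \<and> (\<forall>w. f w \<noteq> 0 \<longrightarrow> set w \<subseteq> {1..n})},
      monoid.mult = (\<lambda>f g w. \<Sum>i\<le>length w. f (take i w) * g (drop i w)),
      one = (\<lambda>w. if w = [] then 1 else 0),
      zero = (\<lambda>w. 0),
      add = (\<lambda>f g w. f w + g w)\<rparr>"

definition free_gen :: "nat \<Rightarrow> nat list \<Rightarrow> 'k::field" where
  "free_gen i = (\<lambda>w. if w = [i] then 1 else 0)"

text \<open>
  The structure map of the algebra: multiplying by \<open>free_const c\<close> on either side is scalar
  multiplication by \<open>c\<close>. In particular ring ideals and algebra ideals coincide, and the quotient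
  of \<open>free_algebra n\<close> by a ring ideal is the quotient as an algebra.
\<close>

definition free_const :: "'k::field \<Rightarrow> nat list \<Rightarrow> 'k" where
  "free_const c = (\<lambda>w. if w = [] then c else 0)"

lemma free_const_mult:
  "free_const c \<otimes>\<^bsub>free_algebra n\<^esub> f = (\<lambda>w. c * f w)"
  "f \<otimes>\<^bsub>free_algebra n\<^esub> free_const c = (\<lambda>w. c * f w)"
proof -
  have "(\<Sum>i\<le>length w. free_const c (take i w) * f (drop i w))
      = (\<Sum>i\<in>{0}. free_const c (take i w) * f (drop i w))" for w
    by (rule sum.mono_neutral_right) (auto simp: free_const_def)
  then show "free_const c \<otimes>\<^bsub>free_algebra n\<^esub> f = (\<lambda>w. c * f w)"
    by (auto simp: free_algebra_def free_const_def)
  have "(\<Sum>i\<le>length w. f (take i w) * free_const c (drop i w))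
      = (\<Sum>i\<in>{length w}. f (take i w) * free_const c (drop i w))" for w
    by (rule sum.mono_neutral_right) (auto simp: free_const_def)
  then show "f \<otimes>\<^bsub>free_algebra n\<^esub> free_const c = (\<lambda>w. c * f w)"
    by (auto simp: free_algebra_def free_const_def mult.commute)
qed

lemma free_const_one: "free_const 1 = \<one>\<^bsub>free_algebra n\<^esub>"
  by (simp add: free_const_def free_algebra_def)

lemma free_const_closed: "free_const c \<in> carrier (free_algebra n)"
proof -
  have "{w. free_const c w \<noteq> 0} \<subseteq> {[]}" by (auto simp: free_const_def)
  then show ?thesis by (auto simp: free_algebra_def free_const_def intro: finite_subset)
qed

lemma free_gen_closed: "i \<in> {1..n} \<Longrightarrow> free_gen i \<in> carrier (free_algebra n)"
proof -
  assume i: "i \<in> {1..n}"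
  have "{w. free_gen i w \<noteq> (0::'a)} \<subseteq> {[i]}" by (auto simp: free_gen_def)
  with i show ?thesis by (auto simp: free_algebra_def free_gen_def intro: finite_subset)
qed

lemma free_mult_closed:
  assumes "f \<in> carrier (free_algebra n)" "g \<in> carrier (free_algebra n)"
  shows "f \<otimes>\<^bsub>free_algebra n\<^esub> g \<in> carrier (free_algebra n)"
proof -
  let ?h = "\<lambda>w. \<Sum>i\<le>length w. f (take i w) * g (drop i w)"
  have factor: "\<exists>u v. w = u @ v \<and> f u \<noteq> 0 \<and> g v \<noteq> 0" if "?h w \<noteq> 0" for w
  proof -
    from that obtain i where "f (take i w) * g (drop i w) \<noteq> 0"
      by (metis (no_types, lifting) sum.neutral)
    then show ?thesis
      by (intro exI[of _ "take i w"] exI[of _ "drop i w"]) auto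
  qed
  have "{w. ?h w \<noteq> 0} \<subseteq> (\<lambda>(u, v). u @ v) ` ({u. f u \<noteq> 0} \<times> {v. g v \<noteq> 0})"
    using factor by fastforce
  moreover have "finite ({u. f u \<noteq> 0} \<times> {v. g v \<noteq> 0})"
    using assms by (auto simp: free_algebra_def)
  ultimately have "finite {w. ?h w \<noteq> 0}"
    using finite_surj by blast
  moreover have "set w \<subseteq> {1..n}" if that: "?h w \<noteq> 0" for w
  proof -
    from factor[OF that] obtain u v where "w = u @ v" "f u \<noteq> 0" "g v \<noteq> 0" by blast
    then show ?thesis using assms by (simp add: free_algebra_def)
  qed
  ultimately show ?thesis by (simp add: free_algebra_def)
qed

lemma free_mult_assoc:
  "(f \<otimes>\<^bsub>free_algebra n\<^esub> g) \<otimes>\<^bsub>free_algebra n\<^esub> h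
     = f \<otimes>\<^bsub>free_algebra n\<^esub> (g \<otimes>\<^bsub>free_algebra n\<^esub> h)"
proof -
  have "(\<Sum>i\<le>length w. (\<Sum>j\<le>length (take i w). f (take j (take i w)) * g (drop j (take i w)))
            * h (drop i w))
      = (\<Sum>j\<le>length w. f (take j w) *
            (\<Sum>k\<le>length (drop j w). g (take k (drop j w)) * h (drop k (drop j w))))"
    (is "?l = ?r") for w
  proof -
    have "?l = (\<Sum>(i, j) \<in> (SIGMA i:{..length w}. {..i}).
                  f (take j w) * g (drop j (take i w)) * h (drop i w))"
      unfolding sum_distrib_right
      by (subst sum.Sigma[symmetric]) (auto intro!: sum.cong simp: min_def)
    also have "\<dots> = (\<Sum>(j, k) \<in> (SIGMA j:{..length w}. {..length w - j}).
                  f (take j w) * (g (take k (drop j w)) * h (drop k (drop j w))))"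
      by (rule sum.reindex_bij_witness[of _ "\<lambda>(j, k). (j + k, j)" "\<lambda>(i, j). (j, i - j)"])
         (auto simp: drop_take mult.assoc)
    also have "\<dots> = ?r"
      unfolding sum_distrib_left
      by (subst sum.Sigma[symmetric]) auto
    finally show ?thesis .
  qed
  then show ?thesis by (simp only: free_algebra_def monoid.simps)
qed

lemma free_algebra_ring: "ring (free_algebra n :: (nat list \<Rightarrow> 'k::field) ring)"
proof (rule ringI)
  let ?A = "free_algebra n :: (nat list \<Rightarrow> 'k) ring"
  show "abelian_group ?A"
  proof (rule abelian_groupI)
    fix f g assume "f \<in> carrier ?A" "g \<in> carrier ?A"
    then have *: "finite ({w. f w \<noteq> 0} \<union> {w. g w \<noteq> 0})"
      and **: "\<forall>w. f w \<noteq> 0 \<or> g w \<noteq> 0 \<longrightarrow> set w \<subseteq> {1..n}"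
      by (auto simp: free_algebra_def)
    have "{w. f w + g w \<noteq> 0} \<subseteq> {w. f w \<noteq> 0} \<union> {w. g w \<noteq> 0}" by auto
    then have "finite {w. f w + g w \<noteq> 0}" using * by (rule finite_subset)
    moreover have "\<forall>w. f w + g w \<noteq> 0 \<longrightarrow> set w \<subseteq> {1..n}" using ** by (metis add_0)
    ultimately show "f \<oplus>\<^bsub>?A\<^esub> g \<in> carrier ?A" by (simp add: free_algebra_def)
  next
    fix f assume "f \<in> carrier ?A"
    then have "(\<lambda>w. - f w) \<in> carrier ?A" by (simp add: free_algebra_def)
    moreover have "(\<lambda>w. - f w) \<oplus>\<^bsub>?A\<^esub> f = \<zero>\<^bsub>?A\<^esub>" by (simp add: free_algebra_def)
    ultimately show "\<exists>g\<in>carrier ?A. g \<oplus>\<^bsub>?A\<^esub> f = \<zero>\<^bsub>?A\<^esub>" by blast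
  qed (auto simp: free_algebra_def algebra_simps)
  show "monoid ?A"
  proof (rule monoidI)
    show "\<one>\<^bsub>?A\<^esub> \<in> carrier ?A"
      using free_const_closed[of 1 n] by (simp add: free_const_one[symmetric])
  qed (auto simp: free_mult_closed free_mult_assoc free_const_mult free_const_one[symmetric])
qed (auto simp: free_algebra_def algebra_simps sum.distrib)


section \<open>The algebra \<open>L\<^sub>n\<^sup>q\<close>\<close>

text \<open>
  Each defining relation \<open>lhs = rhs\<close> is recorded as the element \<open>lhs \<ominus> rhs\<close> of the free algebra.
\<close>

definition L_relators :: "nat \<Rightarrow> 'k::field \<Rightarrow> (nat list \<Rightarrow> 'k) set" where
  "L_relators n q =
     {(free_gen i \<otimes>\<^bsub>free_algebra n\<^esub> free_gen (i + 1)
         \<ominus>\<^bsub>free_algebra n\<^esub> free_const q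
           \<otimes>\<^bsub>free_algebra n\<^esub> (free_gen (i + 1) \<otimes>\<^bsub>free_algebra n\<^esub> free_gen i))
         \<ominus>\<^bsub>free_algebra n\<^esub> free_const (1 - q) | i. 1 \<le> i \<and> i + 1 \<le> n}
   \<union> {free_gen i \<otimes>\<^bsub>free_algebra n\<^esub> free_gen j
         \<ominus>\<^bsub>free_algebra n\<^esub> free_const q
           \<otimes>\<^bsub>free_algebra n\<^esub> (free_gen j \<otimes>\<^bsub>free_algebra n\<^esub> free_gen i)
      | i j. 1 \<le> i \<and> i + 1 < j \<and> j \<le> n \<and> odd (j - i)}
   \<union> {free_gen i \<otimes>\<^bsub>free_algebra n\<^esub> free_gen j
         \<ominus>\<^bsub>free_algebra n\<^esub> free_const (inverse q)
           \<otimes>\<^bsub>free_algebra n\<^esub> (free_gen j \<otimes>\<^bsub>free_algebra n\<^esub> free_gen i)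
      | i j. 1 \<le> i \<and> i + 1 < j \<and> j \<le> n \<and> even (j - i)}"

definition L_algebra :: "nat \<Rightarrow> 'k::field \<Rightarrow> (nat list \<Rightarrow> 'k) set ring" where
  "L_algebra n q = free_algebra n Quot (Idl\<^bsub>free_algebra n\<^esub> (L_relators n q))"

lemma L_relators_closed: "L_relators n q \<subseteq> carrier (free_algebra n)"
proof -
  interpret ring "free_algebra n :: (nat list \<Rightarrow> 'a) ring" by (rule free_algebra_ring)
  show ?thesis
    unfolding L_relators_def
    by (auto intro!: minus_closed m_closed free_gen_closed free_const_closed)
qed

lemma L_algebra_ring: "ring (L_algebra n q)"
  unfolding L_algebra_def
  by (intro ideal.quotient_is_ring ring.genideal_ideal free_algebra_ring L_relators_closed)

end

theory Submission
  imports Defs "HOL-Algebra.Multiplicative_Group"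
begin

text \<open>
  Number the generators backwards, \<open>t\<^sub>i = x\<^bsub>n+1-i\<^esub>\<close>, and put \<open>W\<^sub>0 = 0\<close>, \<open>W\<^sub>1 = 1\<close>,
  \<open>W\<^bsub>k+2\<^esub> = t\<^bsub>k+1\<^esub> W\<^bsub>k+1\<^esub> - W\<^sub>k\<close>. These continuants commute with each other up to powers of
  \<open>q\<close>, the last one is normal, and \<open>t\<^sub>k W\<^sub>k = W\<^bsub>k+1\<^esub> + W\<^bsub>k-1\<^esub>\<close> shows that every element becomes a
  linear combination of monomials in the \<open>W\<^sub>k\<close> after multiplication by such a monomial.
  Let \<open>R\<close> be the quotient by a prime ideal.

  For \<open>1 \<le> k \<le> n\<close> the elements killed on the right by a power of \<open>W\<^sub>k\<close> form a two-sided ideal. As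
  \<open>R\<close> is left noetherian, one power kills all of them, so this ideal is zero unless \<open>W\<^sub>k\<close> is nilpotent.
  Comparing \<open>t\<^sub>k W\<^sub>k\<close> with \<open>W\<^sub>k t\<^sub>k\<close> excludes nilpotency when \<open>q\<close> is not a root of unity.
  So all nonzero \<open>W\<^sub>k\<close> are right regular.

  A zero divisor of \<open>R\<close> can therefore be moved into the span of the monomials. That span is graded
  by the weights of conjugation by the \<open>W\<^sub>k\<close>, which are integer vectors since \<open>q\<close> is not a root of
  unity. Passing to top components makes both factors homogeneous. A homogeneous \<open>a\<close> commutes
  with all monomials up to scalars, so \<open>a b = 0\<close> gives \<open>a R b = 0\<close>, contradicting primeness.
\<close>

section \<open>Algebras over a field\<close>

locale nc_algebra = ring R for R (structure) +
  fixes sm :: "'k::field \<Rightarrow> 'a \<Rightarrow> 'a" (infixr "\<odot>" 75)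
  assumes sm_closed [simp, intro]: "r \<in> carrier R \<Longrightarrow> c \<odot> r \<in> carrier R"
    and sm_r_distr: "r \<in> carrier R \<Longrightarrow> s \<in> carrier R \<Longrightarrow> c \<odot> (r \<oplus> s) = c \<odot> r \<oplus> c \<odot> s"
    and sm_l_distr: "r \<in> carrier R \<Longrightarrow> (c + d) \<odot> r = c \<odot> r \<oplus> d \<odot> r"
    and sm_sm [simp]: "r \<in> carrier R \<Longrightarrow> c \<odot> d \<odot> r = (c * d) \<odot> r"
    and sm_one [simp]: "r \<in> carrier R \<Longrightarrow> 1 \<odot> r = r"
    and sm_mult_l [simp]: "r \<in> carrier R \<Longrightarrow> s \<in> carrier R \<Longrightarrow> c \<odot> r \<otimes> s = c \<odot> (r \<otimes> s)"
    and sm_mult_r [simp]: "r \<in> carrier R \<Longrightarrow> s \<in> carrier R \<Longrightarrow> r \<otimes> c \<odot> s = c \<odot> (r \<otimes> s)"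
begin

lemma sm_zero_l [simp]:
  assumes "r \<in> carrier R"
  shows "0 \<odot> r = \<zero>"
proof -
  have "0 \<odot> r \<oplus> 0 \<odot> r = 0 \<odot> r"
    using sm_l_distr[OF assms, of 0 0] by simp
  then show ?thesis
    using assms by (simp add: add.r_cancel_one')
qed

lemma sm_zero_r [simp]: "c \<odot> \<zero> = \<zero>"
  using sm_sm[of \<zero> c 0] by simp

lemma sm_eq_zero_iff:
  assumes "r \<in> carrier R" "c \<noteq> 0"
  shows "c \<odot> r = \<zero> \<longleftrightarrow> r = \<zero>"
proof
  assume "c \<odot> r = \<zero>"
  then have "inverse c \<odot> c \<odot> r = \<zero>" by simp
  then show "r = \<zero>" using assms by simp
qed simp

section \<open>The calculus of elements commuting up to a scalar\<close>

definition qcomm :: "'k \<Rightarrow> 'a \<Rightarrow> 'a \<Rightarrow> bool" where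
  "qcomm c r s \<longleftrightarrow> r \<otimes> s = c \<odot> (s \<otimes> r)"

lemma qcommD: "qcomm c r s \<Longrightarrow> r \<otimes> s = c \<odot> (s \<otimes> r)"
  by (simp add: qcomm_def)

text \<open>Zero commutes up to every scalar. Hence the base case \<open>continuant 0\<close> of
  later inductions fits whatever power of q is claimed there.\<close>

lemma qcomm_one_r [simp]: "r \<in> carrier R \<Longrightarrow> qcomm 1 r \<one>"
  and qcomm_one_l [simp]: "r \<in> carrier R \<Longrightarrow> qcomm 1 \<one> r"
  and qcomm_zero_r [simp]: "r \<in> carrier R \<Longrightarrow> qcomm c r \<zero>"
  and qcomm_zero_l [simp]: "r \<in> carrier R \<Longrightarrow> qcomm c \<zero> r"
  and qcomm_refl [simp]: "r \<in> carrier R \<Longrightarrow> qcomm 1 r r"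
  by (simp_all add: qcomm_def)

lemma qcomm_sym:
  assumes "r \<in> carrier R" "s \<in> carrier R" "c \<noteq> 0" "qcomm c r s"
  shows "qcomm (inverse c) s r"
  using assms by (simp add: qcomm_def)

lemma qcomm_add_r:
  assumes "r \<in> carrier R" "s \<in> carrier R" "u \<in> carrier R" "qcomm c r s" "qcomm c r u"
  shows "qcomm c r (s \<oplus> u)"
  using assms by (simp add: qcomm_def r_distr l_distr sm_r_distr)

lemma qcomm_add_l:
  assumes "r \<in> carrier R" "s \<in> carrier R" "u \<in> carrier R" "qcomm c s r" "qcomm c u r"
  shows "qcomm c (s \<oplus> u) r"
  using assms by (simp add: qcomm_def r_distr l_distr sm_r_distr)

lemma qcomm_sm_r:
  assumes "r \<in> carrier R" "s \<in> carrier R" "qcomm c r s"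
  shows "qcomm c r (d \<odot> s)"
  using assms by (simp add: qcomm_def mult.commute)

lemma qcomm_sm_l:
  assumes "r \<in> carrier R" "s \<in> carrier R" "qcomm c s r"
  shows "qcomm c (d \<odot> s) r"
  using assms by (simp add: qcomm_def mult.commute)

lemma qcomm_mult_r:
  assumes "r \<in> carrier R" "s \<in> carrier R" "u \<in> carrier R" "qcomm c r s" "qcomm d r u"
  shows "qcomm (c * d) r (s \<otimes> u)"
proof -
  have "r \<otimes> (s \<otimes> u) = (r \<otimes> s) \<otimes> u" using assms by (simp add: m_assoc)
  also have "\<dots> = c \<odot> (s \<otimes> (r \<otimes> u))" using assms by (simp add: qcomm_def m_assoc)
  also have "\<dots> = (c * d) \<odot> ((s \<otimes> u) \<otimes> r)" using assms by (simp add: qcomm_def m_assoc)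
  finally show ?thesis by (simp add: qcomm_def)
qed

lemma qcomm_mult_l:
  assumes "r \<in> carrier R" "s \<in> carrier R" "u \<in> carrier R" "qcomm c s r" "qcomm d u r"
  shows "qcomm (c * d) (s \<otimes> u) r"
proof -
  have "(s \<otimes> u) \<otimes> r = s \<otimes> (u \<otimes> r)" using assms by (simp add: m_assoc)
  also have "\<dots> = d \<odot> (s \<otimes> (r \<otimes> u))" using assms by (simp add: qcomm_def)
  also have "\<dots> = d \<odot> ((s \<otimes> r) \<otimes> u)" using assms(1-3) by (simp add: m_assoc)
  also have "\<dots> = (d * c) \<odot> ((r \<otimes> s) \<otimes> u)" using assms by (simp add: qcomm_def)
  also have "\<dots> = (c * d) \<odot> (r \<otimes> (s \<otimes> u))"
    using assms by (simp add: qcomm_def m_assoc mult.commute)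
  finally show ?thesis by (simp add: qcomm_def)
qed

lemma qcomm_assoc:
  assumes "r \<in> carrier R" "s \<in> carrier R" "u \<in> carrier R" "qcomm c r s"
  shows "r \<otimes> (s \<otimes> u) = c \<odot> (s \<otimes> (r \<otimes> u))"
proof -
  have "r \<otimes> (s \<otimes> u) = (r \<otimes> s) \<otimes> u" using assms by (simp add: m_assoc)
  also have "\<dots> = c \<odot> ((s \<otimes> r) \<otimes> u)" using assms by (simp add: qcomm_def)
  finally show ?thesis using assms by (simp add: m_assoc)
qed

lemma qcomm_pow:
  assumes "a \<in> carrier R" "qcomm c a w" "w \<in> carrier R"
  shows "a \<otimes> w [^] m = c ^ m \<odot> (w [^] m \<otimes> a)"
proof (induction m)
  case (Suc m)
  have "a \<otimes> w [^] Suc m = (a \<otimes> w [^] m) \<otimes> w" using assms by (simp add: m_assoc)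
  also have "\<dots> = c ^ m \<odot> (w [^] m \<otimes> (a \<otimes> w))" using assms by (simp add: Suc m_assoc)
  also have "\<dots> = c ^ Suc m \<odot> (w [^] Suc m \<otimes> a)"
    using assms by (simp add: qcommD[OF assms(2)] m_assoc mult.commute)
  finally show ?case .
qed (use assms in simp)

lemma pow_comm_self: "w \<in> carrier R \<Longrightarrow> w \<otimes> w [^] (m::nat) = w [^] m \<otimes> w"
  by (metis nat_pow_Suc nat_pow_Suc2)

end

section \<open>The Hilbert basis theorem for iterated skew extensions\<close>

text \<open>This covers an iterated skew polynomial extension and all its quotients, since no
  independence of the powers of t_{i+1} is assumed. The scalar c is a unit so that it can be divided
  out of leading coefficients.\<close>

locale skew_generated = nc_algebra R sm for R (structure) and sm :: "'k::field \<Rightarrow> 'a \<Rightarrow> 'a" (infixr "\<odot>" 75) +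
  fixes n :: nat and t :: "nat \<Rightarrow> 'a"
  assumes t_closed [simp, intro]: "t i \<in> carrier R"
    and t_skew: "1 \<le> j \<Longrightarrow> j \<le> i \<Longrightarrow> i < n \<Longrightarrow>
          \<exists>c d. c \<noteq> 0 \<and> t j \<otimes> t (Suc i) = c \<odot> (t (Suc i) \<otimes> t j) \<oplus> d \<odot> \<one>"
begin

section \<open>Subalgebras on the first generators and degrees in the next one\<close>

lemma pow_commute:
  assumes "x \<in> carrier R" "a \<in> carrier R"
  shows "x [^] (m::nat) \<otimes> (x \<otimes> a) = x \<otimes> (x [^] m \<otimes> a)"
    and "x [^] m \<otimes> x \<otimes> a = x \<otimes> (x [^] m \<otimes> a)"
  using assms by (simp_all add: m_assoc[symmetric] nat_pow_comm[of x m 1, simplified])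

inductive_set subalg :: "nat \<Rightarrow> 'a set" for i where
  one: "\<one> \<in> subalg i"
| sm: "r \<in> subalg i \<Longrightarrow> c \<odot> r \<in> subalg i"
| add: "r \<in> subalg i \<Longrightarrow> s \<in> subalg i \<Longrightarrow> r \<oplus> s \<in> subalg i"
| gen: "r \<in> subalg i \<Longrightarrow> 1 \<le> j \<Longrightarrow> j \<le> i \<Longrightarrow> t j \<otimes> r \<in> subalg i"

lemma subalg_closed: "r \<in> subalg i \<Longrightarrow> r \<in> carrier R"
  by (induction rule: subalg.induct) auto

lemma subalg_zero: "\<zero> \<in> subalg i"
  using subalg.sm[OF subalg.one, of 0] by simp

text \<open>
  \<open>below i m\<close> consists of the elements of degree less than \<open>m\<close> in \<open>t (Suc i)\<close>, with coefficients
  in \<open>subalg i\<close> written on the right.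
\<close>

fun below :: "nat \<Rightarrow> nat \<Rightarrow> 'a set" where
  "below i 0 = {\<zero>}"
| "below i (Suc m) = {t (Suc i) [^] m \<otimes> a \<oplus> f | a f. a \<in> subalg i \<and> f \<in> below i m}"

lemma below_closed: "f \<in> below i m \<Longrightarrow> f \<in> carrier R"
  by (induction m arbitrary: f) (auto dest: subalg_closed)

lemma below_zero: "\<zero> \<in> below i m"
proof (induction m)
  case (Suc m)
  have "\<zero> = t (Suc i) [^] m \<otimes> \<zero> \<oplus> \<zero>" by simp
  with Suc show ?case using subalg_zero unfolding below.simps by blast
qed simp

lemma below_SucI: "a \<in> subalg i \<Longrightarrow> f \<in> below i m \<Longrightarrow> t (Suc i) [^] m \<otimes> a \<oplus> f \<in> below i (Suc m)"
  by auto

lemma below_Suc: "f \<in> below i m \<Longrightarrow> f \<in> below i (Suc m)"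
  using below_SucI[OF subalg_zero, of f i m] by (simp add: below_closed)

lemma below_lead: "a \<in> subalg i \<Longrightarrow> t (Suc i) [^] m \<otimes> a \<in> below i (Suc m)"
  using below_SucI[OF _ below_zero, of a i m] by (simp add: subalg_closed)

lemma subalg_below: "a \<in> subalg i \<Longrightarrow> a \<in> below i (Suc 0)"
  using below_lead[of a i 0] by (simp add: subalg_closed)

lemma below_add: "f \<in> below i m \<Longrightarrow> g \<in> below i m \<Longrightarrow> f \<oplus> g \<in> below i m"
proof (induction m arbitrary: f g)
  case (Suc m)
  then obtain a f' b g' where *: "a \<in> subalg i" "b \<in> subalg i" "f' \<in> below i m" "g' \<in> below i m"
    "f = t (Suc i) [^] m \<otimes> a \<oplus> f'" "g = t (Suc i) [^] m \<otimes> b \<oplus> g'" by auto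
  then have "f \<oplus> g = t (Suc i) [^] m \<otimes> (a \<oplus> b) \<oplus> (f' \<oplus> g')"
    by (simp add: subalg_closed below_closed r_distr a_ac)
  with * Suc.IH show ?case by (metis below_SucI subalg.add)
qed simp

lemma below_sm: "f \<in> below i m \<Longrightarrow> c \<odot> f \<in> below i m"
proof (induction m arbitrary: f)
  case (Suc m)
  then obtain a f' where *: "a \<in> subalg i" "f' \<in> below i m" "f = t (Suc i) [^] m \<otimes> a \<oplus> f'" by auto
  then have "c \<odot> f = t (Suc i) [^] m \<otimes> (c \<odot> a) \<oplus> c \<odot> f'"
    by (simp add: subalg_closed below_closed sm_r_distr)
  with * Suc.IH show ?case by (metis below_SucI subalg.sm)
qed simp

lemma below_mult_top: "f \<in> below i m \<Longrightarrow> t (Suc i) \<otimes> f \<in> below i (Suc m)"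
proof (induction m arbitrary: f)
  case 0
  then show ?case using below_zero[of i "Suc 0"] by simp
next
  case (Suc m)
  then obtain a f' where *: "a \<in> subalg i" "f' \<in> below i m" "f = t (Suc i) [^] m \<otimes> a \<oplus> f'" by auto
  then have "t (Suc i) \<otimes> f = t (Suc i) [^] Suc m \<otimes> a \<oplus> t (Suc i) \<otimes> f'"
    by (simp add: subalg_closed below_closed r_distr pow_commute)
  with * Suc.IH show ?case by (metis below_SucI)
qed

text \<open>Each of the m factors t_{i+1} that t_j passes contributes one c to the leading term. The
  constant d of the skew relation only creates terms of lower degree.\<close>

lemma below_mult_lead:
  assumes "1 \<le> j" "j \<le> i" "i < n"
  obtains c where "c \<noteq> 0"
    "\<And>m a. a \<in> subalg i \<Longrightarrow> \<exists>f \<in> below i m. t j \<otimes> (t (Suc i) [^] m \<otimes> a)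
                = c ^ m \<odot> (t (Suc i) [^] m \<otimes> (t j \<otimes> a)) \<oplus> f"
proof -
  let ?x = "t (Suc i)"
  obtain c d where cd: "c \<noteq> 0" "t j \<otimes> ?x = c \<odot> (?x \<otimes> t j) \<oplus> d \<odot> \<one>"
    using t_skew assms by blast
  have "\<exists>f \<in> below i m. t j \<otimes> (?x [^] m \<otimes> a) = c ^ m \<odot> (?x [^] m \<otimes> (t j \<otimes> a)) \<oplus> f"
    if a: "a \<in> subalg i" for a m
  proof (induction m)
    case 0
    then show ?case using a by (auto simp: subalg_closed)
  next
    case (Suc m)
    then obtain f where f: "f \<in> below i m"
      "t j \<otimes> (?x [^] m \<otimes> a) = c ^ m \<odot> (?x [^] m \<otimes> (t j \<otimes> a)) \<oplus> f" by blast
    note [simp] = subalg_closed[OF a] below_closed[OF f(1)]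
    \<comment> \<open>One factor t_{i+1} is pulled to the front, so the skew relation is applied
      once and the induction hypothesis treats the other m factors.\<close>
    have "t j \<otimes> (?x [^] Suc m \<otimes> a) = (t j \<otimes> ?x) \<otimes> (?x [^] m \<otimes> a)"
      by (simp add: m_assoc pow_commute)
    also have "\<dots> = c \<odot> (?x \<otimes> (t j \<otimes> (?x [^] m \<otimes> a))) \<oplus> d \<odot> (?x [^] m \<otimes> a)"
      by (simp add: cd l_distr m_assoc)
    also have "\<dots> = c ^ Suc m \<odot> (?x [^] Suc m \<otimes> (t j \<otimes> a)) \<oplus>
        (c \<odot> (?x \<otimes> f) \<oplus> d \<odot> (?x [^] m \<otimes> a))"
      by (simp add: f(2) r_distr sm_r_distr pow_commute a_assoc)
    finally show ?case
      using a f(1) by (meson below_add below_sm below_mult_top below_lead)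
  qed
  with cd(1) that show thesis by blast
qed

lemma below_mult_below:
  assumes "1 \<le> j" "j \<le> i" "i < n"
  shows "f \<in> below i m \<Longrightarrow> t j \<otimes> f \<in> below i m"
proof (induction m arbitrary: f)
  case (Suc m)
  obtain c where c: "\<And>m a. a \<in> subalg i \<Longrightarrow> \<exists>f \<in> below i m. t j \<otimes> (t (Suc i) [^] m \<otimes> a)
                = c ^ m \<odot> (t (Suc i) [^] m \<otimes> (t j \<otimes> a)) \<oplus> f"
    using below_mult_lead[OF assms] by metis
  from Suc obtain a f' where *: "a \<in> subalg i" "f' \<in> below i m" "f = t (Suc i) [^] m \<otimes> a \<oplus> f'" by auto
  obtain g where g: "g \<in> below i m" "t j \<otimes> (t (Suc i) [^] m \<otimes> a)
                = c ^ m \<odot> (t (Suc i) [^] m \<otimes> (t j \<otimes> a)) \<oplus> g"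
    using c * by blast
  have "t j \<otimes> f = c ^ m \<odot> (t (Suc i) [^] m \<otimes> (t j \<otimes> a)) \<oplus> g \<oplus> t j \<otimes> f'"
    using * g by (simp add: subalg_closed below_closed r_distr)
  then show ?case
    using * g Suc.IH assms by (metis below_add below_sm below_lead below_Suc subalg.gen)
qed simp

text \<open>Words are built by prefixing letters: t_{i+1} raises the degree by one and the earlier
  generators do not raise it.\<close>

lemma subalg_Suc_below:
  assumes "r \<in> subalg (Suc i)" "i < n"
  shows "\<exists>m. r \<in> below i m"
  using assms(1)
proof (induction rule: subalg.induct)
  case one
  then show ?case using subalg_below[OF subalg.one] by blast
next
  case (sm r c)
  then show ?case using below_sm by blast
next
  case (add r s)
  then obtain m k where "r \<in> below i m" "s \<in> below i k" by blast
  moreover have mono: "m \<le> l \<Longrightarrow> below i m \<subseteq> below i l" for m l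
    by (rule lift_Suc_mono_le[of "below i"]) (use below_Suc in blast)
  ultimately have "r \<in> below i (max m k)" "s \<in> below i (max m k)"
    by (meson in_mono max.cobounded1 max.cobounded2)+
  then show ?case using below_add by blast
next
  case (gen r j)
  then show ?case
    using below_mult_below[OF _ _ assms(2)] below_mult_top by (metis le_Suc_eq)
qed

section \<open>Leading coefficients and the ascending chain condition\<close>

definition left_submodule :: "nat \<Rightarrow> 'a set \<Rightarrow> bool" where
  "left_submodule i J \<longleftrightarrow> J \<subseteq> subalg i \<and> \<zero> \<in> J \<and> (\<forall>r\<in>J. \<forall>s\<in>J. r \<oplus> s \<in> J) \<and>
     (\<forall>c. \<forall>r\<in>J. c \<odot> r \<in> J) \<and> (\<forall>j. \<forall>r\<in>J. 1 \<le> j \<longrightarrow> j \<le> i \<longrightarrow> t j \<otimes> r \<in> J)"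

definition left_noetherian :: "nat \<Rightarrow> bool" where
  "left_noetherian i \<longleftrightarrow> (\<forall>J::nat \<Rightarrow> 'a set. (\<forall>k. left_submodule i (J k)) \<longrightarrow>
      (\<forall>k. J k \<subseteq> J (Suc k)) \<longrightarrow> (\<exists>N. \<forall>k\<ge>N. J k = J N))"

text \<open>In a quotient one element may have several leading coefficients of the same degree. All
  of them are collected, so the argument never needs uniqueness.\<close>

definition lead :: "nat \<Rightarrow> nat \<Rightarrow> 'a set \<Rightarrow> 'a set" where
  "lead i m J = {a \<in> subalg i. \<exists>f \<in> below i m. t (Suc i) [^] m \<otimes> a \<oplus> f \<in> J}"

text \<open>Multiplication by t_j turns a leading coefficient a into c^m t_j a, and the unit c^m can
  be divided out inside J.\<close>

lemma lead_left_submodule: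
  assumes "left_submodule (Suc i) J" "i < n"
  shows "left_submodule i (lead i m J)"
  unfolding left_submodule_def
proof (intro conjI ballI allI impI)
  show "lead i m J \<subseteq> subalg i" by (auto simp: lead_def)
  have "t (Suc i) [^] m \<otimes> \<zero> \<oplus> \<zero> \<in> J"
    using assms by (simp add: left_submodule_def)
  then show "\<zero> \<in> lead i m J" unfolding lead_def using subalg_zero below_zero by blast
next
  fix a b assume "a \<in> lead i m J" "b \<in> lead i m J"
  then obtain f g where *: "a \<in> subalg i" "b \<in> subalg i" "f \<in> below i m" "g \<in> below i m"
    "t (Suc i) [^] m \<otimes> a \<oplus> f \<in> J" "t (Suc i) [^] m \<otimes> b \<oplus> g \<in> J" by (auto simp: lead_def)
  have "t (Suc i) [^] m \<otimes> (a \<oplus> b) \<oplus> (f \<oplus> g)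
     = (t (Suc i) [^] m \<otimes> a \<oplus> f) \<oplus> (t (Suc i) [^] m \<otimes> b \<oplus> g)"
    using * by (simp add: subalg_closed below_closed r_distr a_ac)
  also have "\<dots> \<in> J" using * assms(1) by (simp add: left_submodule_def)
  finally show "a \<oplus> b \<in> lead i m J" unfolding lead_def using * subalg.add below_add by blast
next
  fix c a assume "a \<in> lead i m J"
  then obtain f where *: "a \<in> subalg i" "f \<in> below i m" "t (Suc i) [^] m \<otimes> a \<oplus> f \<in> J"
    by (auto simp: lead_def)
  have "t (Suc i) [^] m \<otimes> (c \<odot> a) \<oplus> c \<odot> f = c \<odot> (t (Suc i) [^] m \<otimes> a \<oplus> f)"
    using * by (simp add: subalg_closed below_closed sm_r_distr)
  also have "\<dots> \<in> J" using * assms(1) by (simp add: left_submodule_def)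
  finally show "c \<odot> a \<in> lead i m J" unfolding lead_def using * subalg.sm below_sm by blast
next
  fix j a assume "a \<in> lead i m J" and j: "1 \<le> j" "j \<le> i"
  then obtain f where *: "a \<in> subalg i" "f \<in> below i m" "t (Suc i) [^] m \<otimes> a \<oplus> f \<in> J"
    by (auto simp: lead_def)
  obtain c where c: "c \<noteq> 0" "\<And>m a. a \<in> subalg i \<Longrightarrow> \<exists>f \<in> below i m. t j \<otimes> (t (Suc i) [^] m \<otimes> a)
                = c ^ m \<odot> (t (Suc i) [^] m \<otimes> (t j \<otimes> a)) \<oplus> f"
    using below_mult_lead[OF j assms(2)] by metis
  obtain g where g: "g \<in> below i m" "t j \<otimes> (t (Suc i) [^] m \<otimes> a)
                = c ^ m \<odot> (t (Suc i) [^] m \<otimes> (t j \<otimes> a)) \<oplus> g"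
    using c * by blast
  \<comment> \<open>The lower terms of t_j times the chosen element of J, rescaled so that the
    leading coefficient is t_j a itself.\<close>
  let ?h = "inverse (c ^ m) \<odot> (g \<oplus> t j \<otimes> f)"
  have "t (Suc i) [^] m \<otimes> (t j \<otimes> a) \<oplus> ?h
     = inverse (c ^ m) \<odot> (t j \<otimes> (t (Suc i) [^] m \<otimes> a \<oplus> f))"
    using * g c(1) by (simp add: subalg_closed below_closed r_distr sm_r_distr a_assoc)
  also have "\<dots> \<in> J" using * assms(1) j by (simp add: left_submodule_def)
  finally show "t j \<otimes> a \<in> lead i m J" unfolding lead_def
    using * g j subalg.gen below_sm below_add below_mult_below[OF j assms(2)] by blast
qed

lemma lead_mono: "J \<subseteq> J' \<Longrightarrow> lead i m J \<subseteq> lead i m J'"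
  by (auto simp: lead_def)

lemma lead_Suc:
  assumes "left_submodule (Suc i) J"
  shows "lead i m J \<subseteq> lead i (Suc m) J"
proof
  fix a assume "a \<in> lead i m J"
  then obtain f where *: "a \<in> subalg i" "f \<in> below i m" "t (Suc i) [^] m \<otimes> a \<oplus> f \<in> J"
    by (auto simp: lead_def)
  have "t (Suc i) [^] Suc m \<otimes> a \<oplus> t (Suc i) \<otimes> f = t (Suc i) \<otimes> (t (Suc i) [^] m \<otimes> a \<oplus> f)"
    using * by (simp add: subalg_closed below_closed r_distr pow_commute)
  also have "\<dots> \<in> J" using * assms by (simp add: left_submodule_def)
  finally show "a \<in> lead i (Suc m) J"
    unfolding lead_def using * below_mult_top by blast
qed

text \<open>Hilbert's argument. The leading coefficient modules \<open>A k m\<close> ascend in both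
  the chain index k and the degree m, so they all become constant from a common K on. A chain of
  modules with equal leading coefficients in every degree is constant.\<close>

lemma left_noetherian_Suc:
  assumes "left_noetherian i" "i < n"
  shows "left_noetherian (Suc i)"
  unfolding left_noetherian_def
proof (intro allI impI)
  fix J :: "nat \<Rightarrow> 'a set"
  assume sub: "\<forall>k. left_submodule (Suc i) (J k)" and chain: "\<forall>k. J k \<subseteq> J (Suc k)"
  define A where "A k m = lead i m (J k)" for k m
  have J_mono: "J k \<subseteq> J l" if "k \<le> l" for k l
    using lift_Suc_mono_le[of J] chain that by blast
  have A_sub: "left_submodule i (A k m)" for k m
    unfolding A_def using sub assms(2) lead_left_submodule by blast
  have A_mono: "A k m \<subseteq> A l p" if "k \<le> l" "m \<le> p" for k l m p
  proof -
    have "A k m \<subseteq> A l m" unfolding A_def using J_mono[OF that(1)] by (rule lead_mono)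
    also have "\<dots> \<subseteq> A l p"
      unfolding A_def using lift_Suc_mono_le[of "\<lambda>m. lead i m (J l)"] lead_Suc sub that(2) by blast
    finally show ?thesis .
  qed
  have acc: "\<exists>N. \<forall>k\<ge>N. B k = B N" if "\<forall>k. left_submodule i (B k)" "\<forall>k. B k \<subseteq> B (Suc k)" for B
    using assms(1) that unfolding left_noetherian_def by blast
  \<comment> \<open>The diagonal settles all degrees above M at once; only the finitely many degrees
    up to M need their own bounds.\<close>
  obtain M where M: "\<And>k. k \<ge> M \<Longrightarrow> A k k = A M M"
    using acc[of "\<lambda>k. A k k"] A_sub A_mono by (metis le_Suc_eq order_refl)
  have "\<exists>N. \<forall>k\<ge>N. A k m = A N m" for m
    using acc[of "\<lambda>k. A k m"] A_sub A_mono by (metis le_Suc_eq order_refl)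
  then obtain N where N: "\<And>m k. k \<ge> N m \<Longrightarrow> A k m = A (N m) m" by metis
  define K where "K = Max (insert M (N ` {..M}))"
  have K: "K \<ge> M" "m \<le> M \<Longrightarrow> K \<ge> N m" for m
    unfolding K_def by (rule Max_ge; simp)+
  have stable: "A k m = A K m" if "k \<ge> K" for k m
  proof (cases "m \<le> M")
    case True
    then show ?thesis using N[of m k] N[of m K] K(2)[of m] that by simp
  next
    case False
    \<comment> \<open>For m > M the module is squeezed between \<open>A M M\<close> and a diagonal
      entry, and both are equal.\<close>
    have "A k m \<subseteq> A (max k m) (max k m)" by (rule A_mono) auto
    also have "\<dots> = A M M" by (rule M) (use K(1) that in auto)
    also have "\<dots> \<subseteq> A K m" by (rule A_mono) (use K(1) False in auto)
    finally show ?thesis using A_mono[OF that order_refl] by blast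
  qed
  \<comment> \<open>Induction on the degree bound: an element of \<open>J K\<close> with the same
    leading term is subtracted, and the difference still lies in \<open>J k\<close>.\<close>
  have "f \<in> J K" if k: "k \<ge> K" and "f \<in> below i m" "f \<in> J k" for k f m
    using that(2,3)
  proof (induction m arbitrary: f)
    case 0
    then show ?case using sub by (simp add: left_submodule_def)
  next
    case (Suc m)
    then obtain a f' where *: "a \<in> subalg i" "f' \<in> below i m" "f = t (Suc i) [^] m \<otimes> a \<oplus> f'" by auto
    then have "a \<in> A K m" using Suc stable[OF k, of m] by (auto simp: A_def lead_def)
    then obtain g where g: "g \<in> below i m" "t (Suc i) [^] m \<otimes> a \<oplus> g \<in> J K"
      by (auto simp: A_def lead_def)
    note [simp] = subalg_closed[OF *(1)] below_closed[OF *(2)] below_closed[OF g(1)]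
    \<comment> \<open>\<open>?u\<close> is the common leading term of f and of the element
      \<open>?u \<oplus> g\<close> of \<open>J K\<close>; \<open>?h\<close> is their difference,
      where \<open>?u\<close> has cancelled.\<close>
    let ?u = "t (Suc i) [^] m \<otimes> a" and ?h = "f' \<oplus> (- 1) \<odot> g"
    have h1: "?h = f \<oplus> (- 1) \<odot> (?u \<oplus> g)"
    proof -
      have "f \<oplus> (- 1) \<odot> (?u \<oplus> g) = (?u \<oplus> (- 1) \<odot> ?u) \<oplus> ?h"
        by (simp add: *(3) sm_r_distr a_ac del: sm_mult_r)
      also have "?u \<oplus> (- 1) \<odot> ?u = \<zero>"
        using sm_l_distr[of ?u 1 "- 1"] by simp
      finally show ?thesis by simp
    qed
    have "?h \<in> J k"
      unfolding h1 using Suc.prems(2) g(2) J_mono[OF k] sub by (auto simp: left_submodule_def)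
    moreover have "?h \<in> below i m" using * g below_add below_sm by blast
    ultimately have "?h \<in> J K" by (rule Suc.IH[rotated])
    moreover have "f = (?u \<oplus> g) \<oplus> ?h"
    proof -
      have "(?u \<oplus> g) \<oplus> ?h = f \<oplus> (g \<oplus> (- 1) \<odot> g)" by (simp add: *(3) a_ac)
      also have "g \<oplus> (- 1) \<odot> g = \<zero>" using sm_l_distr[of g 1 "- 1"] by simp
      finally show ?thesis using * by simp
    qed
    ultimately show ?case using g(2) sub unfolding left_submodule_def by metis
  qed
  moreover have "\<exists>m. f \<in> below i m" if "f \<in> J k" for f k
    using that sub subalg_Suc_below[OF _ assms(2)] unfolding left_submodule_def by blast
  ultimately show "\<exists>N. \<forall>k\<ge>N. J k = J N"
    using J_mono by (intro exI[of _ K]) blast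
qed

text \<open>Without generators only multiples of one remain, so a left submodule is zero or
  everything.\<close>

lemma left_noetherian_0: "left_noetherian 0"
  unfolding left_noetherian_def
proof (intro allI impI)
  fix J :: "nat \<Rightarrow> 'a set"
  assume sub: "\<forall>k. left_submodule 0 (J k)" and chain: "\<forall>k. J k \<subseteq> J (Suc k)"
  have G0: "\<exists>c. r = c \<odot> \<one>" if "r \<in> subalg 0" for r
    using that
  proof (induction rule: subalg.induct)
    case one
    show ?case by (rule exI[of _ 1]) simp
  next
    case (add r s)
    then show ?case by (metis sm_l_distr one_closed)
  next
    case (sm r c)
    then show ?case by (metis sm_sm one_closed)
  qed auto
  show "\<exists>N. \<forall>k\<ge>N. J k = J N"
  proof (cases "\<exists>k. J k \<noteq> {\<zero>}")
    case True
    then obtain N r where r: "r \<in> J N" "r \<noteq> \<zero>"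
      using sub unfolding left_submodule_def by blast
    then obtain c where c: "r = c \<odot> \<one>" using G0 sub unfolding left_submodule_def by blast
    then have "c \<noteq> 0" using r by auto
    have "J k = subalg 0" if "k \<ge> N" for k
    proof -
      have "r \<in> J k" using lift_Suc_mono_le[of J] chain that r(1) by blast
      \<comment> \<open>Scale r = c 1 by d / c.\<close>
      then have "d \<odot> \<one> \<in> J k" for d
        using sub c \<open>c \<noteq> 0\<close> unfolding left_submodule_def
        by (metis sm_sm one_closed nonzero_divide_eq_eq)
      then show ?thesis using sub G0 unfolding left_submodule_def by blast
    qed
    then show ?thesis by blast
  qed auto
qed

lemma left_noetherian_le: "i \<le> n \<Longrightarrow> left_noetherian i"
  by (induction i) (auto intro: left_noetherian_0 left_noetherian_Suc)

end

section \<open>Prime algebras with a quantum torus chart\<close>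

lemma power_int_inj:
  fixes q :: "'k::field"
  assumes "q \<noteq> 0" "\<And>m::nat. m \<ge> 1 \<Longrightarrow> q ^ m \<noteq> 1" "q powi i = q powi j"
  shows "i = j"
proof -
  have 1: "d = 0" if "q powi d = 1" "d \<ge> 0" for d
  proof (rule ccontr)
    assume "d \<noteq> 0"
    then have "nat d \<ge> 1" using that by linarith
    moreover have "q ^ nat d = 1" using that by (simp add: power_int_def)
    ultimately show False using assms(2) by blast
  qed
  have "q powi (i - j) = 1" "q powi (j - i) = 1"
    using assms(1,3) by (simp_all add: power_int_diff)
  then show ?thesis using 1[of "i - j"] 1[of "j - i"] by linarith
qed

text \<open>The \<open>v i\<close> satisfy the relations of a quantum torus with exponent matrix
  \<open>h\<close>, but their monomials may be linearly dependent in R. Cancellation is assumed on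
  the right only.\<close>

locale quantum_torus_chart = nc_algebra R sm for R (structure) and sm :: "'k::field \<Rightarrow> 'a \<Rightarrow> 'a" (infixr "\<odot>" 75) +
  fixes q :: 'k and S :: "'i set" and v :: "'i \<Rightarrow> 'a" and h :: "'i \<Rightarrow> 'i \<Rightarrow> int"
  assumes q_nonzero: "q \<noteq> 0"
    and q_not_root: "\<And>m::nat. m \<ge> 1 \<Longrightarrow> q ^ m \<noteq> 1"
    and v_closed [simp, intro]: "v i \<in> carrier R"
    and v_qcomm: "i \<in> S \<Longrightarrow> j \<in> S \<Longrightarrow> qcomm (q powi h i j) (v i) (v j)"
    and v_regular: "j \<in> S \<Longrightarrow> r \<in> carrier R \<Longrightarrow> r \<otimes> v j = \<zero> \<Longrightarrow> r = \<zero>"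
begin

section \<open>Formal sums of monomials and their weights\<close>

fun mon :: "'i list \<Rightarrow> 'a" where
  "mon [] = \<one>"
| "mon (k # ks) = v k \<otimes> mon ks"

text \<open>Formal sums are lists of terms, with repetitions and zero coefficients allowed. Since R
  need not have the monomials as a basis, the number of listed terms serves as the induction
  measure.\<close>

fun ev :: "('k \<times> 'i list) list \<Rightarrow> 'a" where
  "ev [] = \<zero>"
| "ev ((c, ks) # xs) = c \<odot> mon ks \<oplus> ev xs"

definition valid :: "('k \<times> 'i list) list \<Rightarrow> bool" where
  "valid xs \<longleftrightarrow> snd ` set xs \<subseteq> lists S"

text \<open>The exponent of q produced when \<open>v j\<close> moves from the right of
  \<open>mon ks\<close> to its left.\<close>

definition wt :: "'i \<Rightarrow> 'i list \<Rightarrow> int" where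
  "wt j ks = sum_list (map (\<lambda>k. h k j) ks)"

text \<open>Conjugation by \<open>v j\<close> acts on formal sums in this way, with a power of q
  depending on the weight of the word.\<close>

definition twist :: "('i list \<Rightarrow> 'k) \<Rightarrow> ('k \<times> 'i list) list \<Rightarrow> ('k \<times> 'i list) list" where
  "twist f xs = map (\<lambda>(c, ks). (f ks * c, ks)) xs"

definition times :: "('k \<times> 'i list) list \<Rightarrow> ('k \<times> 'i list) list \<Rightarrow> ('k \<times> 'i list) list" where
  "times xs ys = concat (map (\<lambda>(c, ks). map (\<lambda>(d, ls). (c * d, ks @ ls)) ys) xs)"

lemma valid_simps [simp]:
  "valid []" "valid (x # xs) \<longleftrightarrow> snd x \<in> lists S \<and> valid xs"
  "valid (xs @ ys) \<longleftrightarrow> valid xs \<and> valid ys"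
  by (auto simp: valid_def)

lemma valid_filter: "valid xs \<Longrightarrow> valid (filter Q xs)"
  by (auto simp: valid_def)

lemma twist_simps [simp]:
  "twist f [] = []" "twist f ((c, ks) # xs) = (f ks * c, ks) # twist f xs"
  "length (twist f xs) = length xs"
  by (auto simp: twist_def)

lemma twist_snd [simp]: "snd ` set (twist f xs) = snd ` set xs"
  by (force simp: twist_def image_image)

lemma valid_twist [simp]: "valid (twist f xs) = valid xs"
  by (simp add: valid_def)

lemma mon_closed [simp, intro]: "mon ks \<in> carrier R"
  by (induction ks) auto

lemma ev_closed [simp, intro]: "ev xs \<in> carrier R"
  by (induction xs rule: ev.induct) auto

lemma mon_append: "mon (ks @ ls) = mon ks \<otimes> mon ls"
  by (induction ks) (auto simp: m_assoc)

lemma ev_append: "ev (xs @ ys) = ev xs \<oplus> ev ys"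
  by (induction xs rule: ev.induct) (auto simp: a_assoc)

lemma ev_twist_const: "ev (twist (\<lambda>_. c) xs) = c \<odot> ev xs"
  by (induction xs rule: ev.induct) (auto simp: sm_r_distr)

lemma ev_filter: "ev xs = ev (filter Q xs) \<oplus> ev (filter (\<lambda>x. \<not> Q x) xs)"
  by (induction xs rule: ev.induct) (auto simp: a_ac)

lemma times_simps [simp]:
  "times [] ys = []"
  "times ((c, ks) # xs) ys = map (\<lambda>(d, ls). (c * d, ks @ ls)) ys @ times xs ys"
  by (auto simp: times_def)

lemma valid_times [simp]: "valid xs \<Longrightarrow> valid ys \<Longrightarrow> valid (times xs ys)"
proof (induction xs)
  case (Cons x xs)
  have "valid (map (\<lambda>(d, ls). (fst x * d, snd x @ ls)) ys)"
    using Cons.prems by (induction ys) auto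
  with Cons show ?case by (cases x) auto
qed simp

lemma ev_times: "ev (times xs ys) = ev xs \<otimes> ev ys"
proof (induction xs rule: ev.induct)
  case (2 c ks xs)
  have "ev (map (\<lambda>(d, ls). (c * d, ks @ ls)) ys) = (c \<odot> mon ks) \<otimes> ev ys"
    by (induction ys rule: ev.induct) (auto simp: mon_append r_distr sm_r_distr mult.commute)
  with 2 show ?case by (simp add: ev_append l_distr del: sm_mult_l)
qed simp

lemma qcomm_mon_v: "ks \<in> lists S \<Longrightarrow> j \<in> S \<Longrightarrow> qcomm (q powi wt j ks) (mon ks) (v j)"
proof (induction ks)
  case (Cons k ks)
  then have "qcomm (q powi h k j * q powi wt j ks) (v k \<otimes> mon ks) (v j)"
    by (intro qcomm_mult_l v_qcomm) auto
  then show ?case by (simp add: wt_def power_int_add q_nonzero)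
qed (simp add: wt_def)

lemma ev_v: "valid xs \<Longrightarrow> j \<in> S \<Longrightarrow> ev xs \<otimes> v j = v j \<otimes> ev (twist (\<lambda>ks. q powi wt j ks) xs)"
proof (induction xs rule: ev.induct)
  case (2 c ks xs)
  then show ?case
    by (simp add: l_distr r_distr qcommD[OF qcomm_mon_v] mult.commute)
qed simp

text \<open>The offset u normalises the factors so that words of weight u keep their
  coefficients.\<close>

lemma v_ev:
  "valid xs \<Longrightarrow> j \<in> S \<Longrightarrow>
     q powi u \<odot> (v j \<otimes> ev xs) = ev (twist (\<lambda>ks. q powi (u - wt j ks)) xs) \<otimes> v j"
proof (induction xs rule: ev.induct)
  case (2 c ks xs)
  have "mon ks \<otimes> v j = q powi wt j ks \<odot> (v j \<otimes> mon ks)"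
    using 2 by (auto intro!: qcommD qcomm_mon_v)
  moreover have e: "q powi u * c = q powi (u - wt j ks) * c * q powi wt j ks"
    using q_nonzero by (simp add: power_int_diff)
  ultimately show ?case
    using 2 unfolding ev.simps twist_simps by (simp add: l_distr r_distr sm_r_distr e del: mult_cancel_right)
qed simp

text \<open>An Ore condition for free: passing a monomial only rescales coefficients.\<close>

lemma ev_mon:
  assumes "valid xs" "ks \<in> lists S"
  obtains ys where "valid ys" "ev xs \<otimes> mon ks = mon ks \<otimes> ev ys"
proof -
  have "\<exists>ys. valid ys \<and> ev xs \<otimes> mon ks = mon ks \<otimes> ev ys"
    using assms(2,1)
  proof (induction ks arbitrary: xs)
    case (Cons k ks)
    let ?ys = "twist (\<lambda>ks. q powi wt k ks) xs"
    obtain zs where zs: "valid zs" "ev ?ys \<otimes> mon ks = mon ks \<otimes> ev zs"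
      using Cons.IH[of ?ys] Cons.prems by auto
    have "ev xs \<otimes> mon (k # ks) = (ev xs \<otimes> v k) \<otimes> mon ks" by (simp add: m_assoc)
    also have "\<dots> = v k \<otimes> (ev ?ys \<otimes> mon ks)"
      using Cons by (simp add: ev_v m_assoc)
    also have "\<dots> = mon (k # ks) \<otimes> ev zs" by (simp add: zs m_assoc)
    finally show ?case using zs(1) by blast
  qed auto
  with that show thesis by blast
qed

lemma mon_regular: "ks \<in> lists S \<Longrightarrow> r \<in> carrier R \<Longrightarrow> r \<otimes> mon ks = \<zero> \<Longrightarrow> r = \<zero>"
proof (induction ks arbitrary: r)
  case (Cons k ks)
  then have "(r \<otimes> v k) \<otimes> mon ks = \<zero>" by (simp add: m_assoc)
  then have "r \<otimes> v k = \<zero>" using Cons by auto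
  then show ?case using v_regular Cons by auto
qed simp

text \<open>Multiplying a relation by \<open>v j\<close> on either side and comparing removes one term.\<close>

lemma weight_independent:
  assumes "j \<in> S"
  shows "r \<in> carrier R \<Longrightarrow> qcomm (q powi w) r (v j) \<Longrightarrow> valid xs \<Longrightarrow>
     \<forall>ks \<in> snd ` set xs. wt j ks \<noteq> w \<Longrightarrow> r \<oplus> ev xs = \<zero> \<Longrightarrow> r = \<zero>"
proof (induction xs arbitrary: r rule: length_induct)
  case (1 xs)
  show ?case
  proof (cases xs)
    case Nil
    then show ?thesis using 1 by simp
  next
    case (Cons x ys)
    obtain c ks where x: "x = (c, ks)" by (cases x)
    \<comment> \<open>The weight of the first listed word. Its factor \<open>f ks\<close> is 1, so
      this is the term that will cancel.\<close>
    define u where "u = wt j ks"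
    define f where "f ls = q powi (u - wt j ls)" for ls
    have val: "ks \<in> lists S" "valid ys" using 1 Cons x by auto
    have "u \<noteq> w" using 1 Cons x by (simp add: u_def)
    have vr: "q powi u \<odot> (v j \<otimes> r) = (q powi (u - w) \<odot> r) \<otimes> v j"
      using 1 q_nonzero by (simp add: qcomm_def power_int_diff)
    \<comment> \<open>Multiply the relation by q^u \<open>v j\<close> on the left and move
      \<open>v j\<close> to the right end, where it can be cancelled.\<close>
    have "(q powi (u - w) \<odot> r \<oplus> ev (twist f xs)) \<otimes> v j
        = q powi u \<odot> (v j \<otimes> (r \<oplus> ev xs))"
      unfolding f_def using 1(2) vr v_ev[OF 1(4) assms, of u]
      by (simp add: l_distr r_distr sm_r_distr del: sm_mult_l)
    also have "\<dots> = \<zero>" using 1 by simp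
    finally have e1: "q powi (u - w) \<odot> r \<oplus> ev (twist f xs) = \<zero>"
      using v_regular[OF assms] 1 by simp
    have fks: "f ks = 1" by (simp add: f_def u_def)
    have e2: "(- 1) \<odot> r \<oplus> ((- c) \<odot> mon ks \<oplus> (- 1) \<odot> ev ys) = \<zero>"
      using arg_cong[OF 1(6), of "\<lambda>z. (- 1) \<odot> z"] 1(2) Cons x
      by (simp add: sm_r_distr)
    have e3: "ev (twist (\<lambda>ls. f ls - 1) zs) = ev (twist f zs) \<oplus> (- 1) \<odot> ev zs" for zs
    proof (induction zs rule: ev.induct)
      case (2 d ls zs)
      have "((f ls - 1) * d) \<odot> mon ls = (f ls * d) \<odot> mon ls \<oplus> (- d) \<odot> mon ls"
        by (simp add: sm_l_distr[symmetric] algebra_simps)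
      with 2 show ?case by (simp add: sm_r_distr a_ac)
    qed simp
    have e4: "(q powi (u - w) - 1) \<odot> r = q powi (u - w) \<odot> r \<oplus> (- 1) \<odot> r"
      using 1(2) by (simp add: sm_l_distr[symmetric])
    have e5: "c \<odot> mon ks \<oplus> (- c) \<odot> mon ks = \<zero>"
      by (simp add: sm_l_distr[symmetric])
    \<comment> \<open>Subtracting the original relation removes the word \<open>ks\<close>. What
      remains has the same shape with \<open>ys\<close> for \<open>xs\<close>, and r is multiplied
      by a scalar that is nonzero because u and w differ.\<close>
    have "(q powi (u - w) - 1) \<odot> r \<oplus> ev (twist (\<lambda>ls. f ls - 1) ys)
       = (q powi (u - w) \<odot> r \<oplus> ev (twist f ys)) \<oplus> ((- 1) \<odot> r \<oplus> (- 1) \<odot> ev ys)"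
      using 1(2) by (simp add: e3 e4 a_ac)
    also have "\<dots> = (q powi (u - w) \<odot> r \<oplus> ev (twist f ys)) \<oplus> ((- 1) \<odot> r \<oplus> (- 1) \<odot> ev ys)
       \<oplus> (c \<odot> mon ks \<oplus> (- c) \<odot> mon ks)"
      using 1(2) by (simp add: e5)
    also have "\<dots> = (q powi (u - w) \<odot> r \<oplus> ev (twist f xs)) \<oplus>
          ((- 1) \<odot> r \<oplus> ((- c) \<odot> mon ks \<oplus> (- 1) \<odot> ev ys))"
      using 1(2) Cons x fks by (simp add: a_ac)
    also have "\<dots> = \<zero>" by (simp add: e1 e2)
    finally have sum0: "(q powi (u - w) - 1) \<odot> r \<oplus> ev (twist (\<lambda>ls. f ls - 1) ys) = \<zero>" .
    have "(q powi (u - w) - 1) \<odot> r = \<zero>"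
      by (rule 1(1)[rule_format, OF _ _ _ _ _ sum0])
         (use 1 Cons val in \<open>auto intro: qcomm_sm_l\<close>)
    moreover have "q powi (u - w) - 1 \<noteq> 0"
      using power_int_inj[OF q_nonzero q_not_root, of "u - w" 0] \<open>u \<noteq> w\<close> by auto
    ultimately show ?thesis using sm_eq_zero_iff 1(2) by blast
  qed
qed

lemma qcomm_ev_v:
  assumes "valid xs" "j \<in> S" "\<forall>ks \<in> snd ` set xs. wt j ks = w"
  shows "qcomm (q powi w) (ev xs) (v j)"
  using assms
proof (induction xs rule: ev.induct)
  case (2 c ks xs)
  then show ?case using qcomm_mon_v[of ks j]
    by (auto intro!: qcomm_add_l qcomm_sm_l)
qed simp

text \<open>Words may be dependent, but different weights are not: the part of weight w is set
  against all other words.\<close>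

lemma weight_component:
  assumes "j \<in> S" "valid xs" "ev xs = \<zero>"
  shows "ev (filter (\<lambda>x. wt j (snd x) = w) xs) = \<zero>"
proof (rule weight_independent[OF assms(1) ev_closed])
  show "ev (filter (\<lambda>x. wt j (snd x) = w) xs) \<oplus> ev (filter (\<lambda>x. wt j (snd x) \<noteq> w) xs) = \<zero>"
    using ev_filter[of xs] assms(3) by simp
  show "qcomm (q powi w) (ev (filter (\<lambda>x. wt j (snd x) = w) xs)) (v j)"
    using assms by (intro qcomm_ev_v) (auto simp: valid_filter)
qed (use assms in \<open>auto simp: valid_filter\<close>)

lemma wt_append: "wt j (ks @ ls) = wt j ks + wt j ls"
  by (simp add: wt_def)

text \<open>Weights add under concatenation, so the sum of two upper bounds is reached only by pairs
  reaching both bounds. The equality holds between lists, before evaluation.\<close>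

lemma filter_times_top:
  assumes "\<forall>x \<in> set xs. wt j (snd x) \<le> a" "\<forall>y \<in> set ys. wt j (snd y) \<le> b"
  shows "filter (\<lambda>z. wt j (snd z) = a + b) (times xs ys)
    = times (filter (\<lambda>x. wt j (snd x) = a) xs) (filter (\<lambda>y. wt j (snd y) = b) ys)"
  using assms(1)
proof (induction xs rule: ev.induct)
  case (2 c ks xs)
  have "filter (\<lambda>z. wt j (snd z) = a + b) (map (\<lambda>(d, ls). (c * d, ks @ ls)) ys)
     = (if wt j ks = a then map (\<lambda>(d, ls). (c * d, ks @ ls)) (filter (\<lambda>y. wt j (snd y) = b) ys) else [])"
    using assms(2) 2(2) by (induction ys) (auto simp: wt_append)
  with 2 show ?case by auto
qed simp

end

section \<open>Absence of zero divisors by reduction to homogeneous elements\<close>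

locale prime_quantum_torus_chart = quantum_torus_chart R sm q S v h
  for R (structure) and sm :: "'k::field \<Rightarrow> 'a \<Rightarrow> 'a" (infixr "\<odot>" 75)
    and q :: 'k and S :: "'i set" and v :: "'i \<Rightarrow> 'a" and h :: "'i \<Rightarrow> 'i \<Rightarrow> int" +
  assumes prime: "a \<in> carrier R \<Longrightarrow> b \<in> carrier R \<Longrightarrow>
        (\<And>r. r \<in> carrier R \<Longrightarrow> a \<otimes> (r \<otimes> b) = \<zero>) \<Longrightarrow> a = \<zero> \<or> b = \<zero>"
    and chart: "r \<in> carrier R \<Longrightarrow> \<exists>ks xs. ks \<in> lists S \<and> valid xs \<and> r \<otimes> mon ks = ev xs"
begin

text \<open>A homogeneous element passes every monomial up to a scalar, so the product stays zero
  with any \<open>ev zs\<close> in between. The chart extends this to an arbitrary r in between, and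
  primeness applies.\<close>

lemma homogeneous_zero_divisor:
  assumes ha: "\<And>j. j \<in> S \<Longrightarrow> qcomm (q powi f j) (ev xs) (v j)"
    and hb: "\<And>j. j \<in> S \<Longrightarrow> qcomm (q powi g j) (ev ys) (v j)"
    and ab: "ev xs \<otimes> ev ys = \<zero>"
  shows "ev xs = \<zero> \<or> ev ys = \<zero>"
proof (rule prime)
  fix r assume r: "r \<in> carrier R"
  have mon: "ks \<in> lists S \<Longrightarrow> \<exists>c. qcomm c u (mon ks)"
    if "u \<in> carrier R" "\<And>j. j \<in> S \<Longrightarrow> qcomm (q powi f j) u (v j)" for u f ks
  proof (induction ks)
    case Nil
    then show ?case using that by (auto intro: exI[of _ 1])
  next
    case (Cons k ks)
    then obtain c where "qcomm c u (mon ks)" by auto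
    then have "qcomm (q powi f k * c) u (v k \<otimes> mon ks)"
      using that Cons.prems by (intro qcomm_mult_r) auto
    then show ?case by auto
  qed
  obtain ks zs where z: "ks \<in> lists S" "valid zs" "r \<otimes> mon ks = ev zs" using chart[OF r] by blast
  have "ev xs \<otimes> (ev zs \<otimes> ev ys) = \<zero>" using z(2)
  proof (induction zs rule: ev.induct)
    case (2 d ls zs)
    then obtain c where "qcomm c (ev xs) (mon ls)" using mon[OF _ ha, of ls] by auto
    then have "ev xs \<otimes> (mon ls \<otimes> ev ys) = c \<odot> (mon ls \<otimes> (ev xs \<otimes> ev ys))"
      by (intro qcomm_assoc) auto
    also have "\<dots> = \<zero>" by (simp add: ab)
    finally show ?case using 2 by (simp add: l_distr r_distr)
  qed simp
  then have 0: "ev xs \<otimes> ((r \<otimes> mon ks) \<otimes> ev ys) = \<zero>" by (simp only: z(3))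
  obtain c where c: "qcomm c (ev ys) (mon ks)" using mon[OF _ hb z(1)] by auto
  \<comment> \<open>Homogeneity of the second factor brings \<open>mon ks\<close> next to r, where
    the chart turns r into a formal sum.\<close>
  have "(ev xs \<otimes> (r \<otimes> ev ys)) \<otimes> mon ks = ev xs \<otimes> (r \<otimes> (ev ys \<otimes> mon ks))"
    using r by (simp add: m_assoc)
  also have "\<dots> = c \<odot> (ev xs \<otimes> ((r \<otimes> mon ks) \<otimes> ev ys))"
    using r by (simp add: qcommD[OF c] m_assoc)
  finally have "(ev xs \<otimes> (r \<otimes> ev ys)) \<otimes> mon ks = \<zero>" by (simp add: 0)
  then show "ev xs \<otimes> (r \<otimes> ev ys) = \<zero>"
    using mon_regular[OF z(1)] r by simp
qed auto

lemma ev_no_zero_divisors: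
  "valid xs \<Longrightarrow> valid ys \<Longrightarrow> ev xs \<otimes> ev ys = \<zero> \<Longrightarrow> ev xs = \<zero> \<or> ev ys = \<zero>"
proof (induction "length xs + length ys" arbitrary: xs ys rule: less_induct)
  case less
  \<comment> \<open>\<open>Max\<close> of the empty set is unspecified, which is harmless: bounds
    over an empty list are vacuous and an empty sum is zero.\<close>
  define top where "top j zs = Max ((\<lambda>z. wt j (snd z)) ` set zs)" for j and zs :: "('k \<times> 'i list) list"
  have top: "\<forall>z \<in> set zs. wt j (snd z) \<le> top j zs" for j zs by (auto simp: top_def)
  show ?case
  proof (cases "\<forall>j \<in> S. (\<forall>x \<in> set xs. wt j (snd x) = top j xs) \<and> (\<forall>y \<in> set ys. wt j (snd y) = top j ys)")
    case True
    show ?thesis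
    proof (rule homogeneous_zero_divisor)
      show "qcomm (q powi top j xs) (ev xs) (v j)" if "j \<in> S" for j
        using True that less.prems by (intro qcomm_ev_v) auto
      show "qcomm (q powi top j ys) (ev ys) (v j)" if "j \<in> S" for j
        using True that less.prems by (intro qcomm_ev_v) auto
    qed (use less.prems in auto)
  next
    case False
    then obtain j where j: "j \<in> S" and
      ne: "(\<exists>x \<in> set xs. wt j (snd x) \<noteq> top j xs) \<or> (\<exists>y \<in> set ys. wt j (snd y) \<noteq> top j ys)" by blast
    let ?P = "\<lambda>zs z. wt j (snd z) = top j zs"
    let ?hi = "\<lambda>zs. filter (?P zs) zs" and ?lo = "\<lambda>zs. filter (\<lambda>z. \<not> ?P zs z) zs"
    have split: "ev zs = ev (?hi zs) \<oplus> ev (?lo zs)" for zs by (rule ev_filter)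
    \<comment> \<open>The maximum is attained, so dropping the top part shortens the list.\<close>
    have hi_pos: "length (?lo zs) < length zs" if "zs \<noteq> []" for zs
    proof -
      have "top j zs \<in> (\<lambda>z. wt j (snd z)) ` set zs"
        unfolding top_def using that by (intro Max_in) auto
      then show ?thesis by (auto intro!: length_filter_less)
    qed
    have short: "length (?hi xs) + length (?hi ys) < length xs + length ys"
      using ne
    proof
      assume "\<exists>x \<in> set xs. wt j (snd x) \<noteq> top j xs"
      then have "length (?hi xs) < length xs" by (auto intro: length_filter_less)
      then show ?thesis using length_filter_le[of "?P ys" ys] by linarith
    next
      assume "\<exists>y \<in> set ys. wt j (snd y) \<noteq> top j ys"
      then have "length (?hi ys) < length ys" by (auto intro: length_filter_less)
      then show ?thesis using length_filter_le[of "?P xs" xs] by linarith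
    qed
    \<comment> \<open>The product of the top parts is a weight component of the vanishing
      product.\<close>
    have "ev (times (?hi xs) (?hi ys)) = \<zero>"
      using weight_component[OF j, of "times xs ys" "top j xs + top j ys"] less.prems
      by (simp add: ev_times filter_times_top[OF top top])
    then have "ev (?hi xs) = \<zero> \<or> ev (?hi ys) = \<zero>"
      using less.hyps[OF short] less.prems by (simp add: ev_times valid_filter)
    then show ?thesis
    proof
      assume hi: "ev (?hi xs) = \<zero>"
      then have e: "ev xs = ev (?lo xs)" using split[of xs] by simp
      show ?thesis
      proof (cases "xs = []")
        case False
        then show ?thesis using less.hyps[of "?lo xs" ys] less.prems hi_pos[OF False] e
          by (simp add: valid_filter)
      qed simp
    next
      assume hi: "ev (?hi ys) = \<zero>"
      then have e: "ev ys = ev (?lo ys)" using split[of ys] by simp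
      show ?thesis
      proof (cases "ys = []")
        case False
        then show ?thesis using less.hyps[of xs "?lo ys"] less.prems hi_pos[OF False] e
          by (simp add: valid_filter)
      qed simp
    qed
  qed
qed

text \<open>Both factors are cleared of denominators on the right. The denominator of r stands
  between r and s and is moved past the cleared s by the Ore condition.\<close>

theorem no_zero_divisors:
  assumes r: "r \<in> carrier R" and s: "s \<in> carrier R" and rs: "r \<otimes> s = \<zero>"
  shows "r = \<zero> \<or> s = \<zero>"
proof -
  obtain ks xs where x: "ks \<in> lists S" "valid xs" "r \<otimes> mon ks = ev xs" using chart[OF r] by blast
  obtain ls ys where y: "ls \<in> lists S" "valid ys" "s \<otimes> mon ls = ev ys" using chart[OF s] by blast
  obtain zs where z: "valid zs" "ev ys \<otimes> mon ks = mon ks \<otimes> ev zs"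
    using ev_mon[OF y(2) x(1)] .
  have "ev xs \<otimes> ev zs = r \<otimes> (ev ys \<otimes> mon ks)"
    using r by (simp add: x(3)[symmetric] z(2) m_assoc)
  also have "\<dots> = (r \<otimes> s) \<otimes> (mon ls \<otimes> mon ks)"
    using r s by (simp add: y(3)[symmetric] m_assoc)
  finally have "ev xs \<otimes> ev zs = \<zero>" by (simp add: rs)
  then consider "ev xs = \<zero>" | "ev zs = \<zero>" using ev_no_zero_divisors x(2) z(1) by blast
  then show ?thesis
  proof cases
    case 1
    then show ?thesis using mon_regular x r by metis
  next
    case 2
    then have "ev ys = \<zero>" using mon_regular[OF x(1)] z(2) by simp
    then show ?thesis using mon_regular y s by metis
  qed
qed

end

section \<open>Quantum continuants\<close>

locale L_relations = nc_algebra R sm for R (structure) and sm :: "'k::field \<Rightarrow> 'a \<Rightarrow> 'a" (infixr "\<odot>" 75) +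
  fixes n :: nat and q :: 'k and t :: "nat \<Rightarrow> 'a"
  assumes q_nonzero: "q \<noteq> 0"
    and t_closed [simp, intro]: "t i \<in> carrier R"
    and t_adjacent: "1 \<le> i \<Longrightarrow> i < n \<Longrightarrow>
          t (Suc i) \<otimes> t i = q \<odot> (t i \<otimes> t (Suc i)) \<oplus> (1 - q) \<odot> \<one>"
    and t_far: "1 \<le> i \<Longrightarrow> Suc i < j \<Longrightarrow> j \<le> n \<Longrightarrow>
          qcomm (if even (i + j) then inverse q else q) (t j) (t i)"
begin

text \<open>Euler's continuants with signs, noncommutative analogues of tridiagonal determinants.
  The index is shifted: W_{k+1} involves t_1, ..., t_k.\<close>

fun continuant :: "nat \<Rightarrow> 'a" where
  "continuant 0 = \<zero>"
| "continuant (Suc 0) = \<one>"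
| "continuant (Suc (Suc k)) = t (Suc k) \<otimes> continuant (Suc k) \<oplus> (- 1) \<odot> continuant k"

lemma continuant_closed [simp, intro]: "continuant k \<in> carrier R"
  by (induction k rule: continuant.induct) auto

section \<open>Commutation of continuants with generators and with each other\<close>

lemma t_continuant: "t (Suc k) \<otimes> continuant (Suc k) = continuant (Suc (Suc k)) \<oplus> continuant k"
proof -
  have "t (Suc k) \<otimes> continuant (Suc k) \<oplus> ((- 1) \<odot> continuant k \<oplus> continuant k) = t (Suc k) \<otimes> continuant (Suc k)"
    using sm_l_distr[of "continuant k" "- 1" 1] by simp
  then show ?thesis by (simp add: a_assoc)
qed

text \<open>W_k involves only generators with index below k, all at distance at least two from j. So
  only far relations occur, and their alternating powers of q agree on both summands of the
  recursion.\<close>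

lemma qcomm_t_continuant_above:
  "k < j \<Longrightarrow> j \<le> n \<Longrightarrow>
     qcomm (if odd k then 1 else if even j then q else inverse q) (t j) (continuant k)"
proof (induction k rule: continuant.induct)
  case (3 k)
  have "qcomm ((if even (Suc k + j) then inverse q else q) *
      (if odd (Suc k) then 1 else if even j then q else inverse q)) (t j) (t (Suc k) \<otimes> continuant (Suc k))"
    by (intro qcomm_mult_r 3(1) t_far) (use 3 in auto)
  moreover have "(if even (Suc k + j) then inverse q else q) *
      (if odd (Suc k) then 1 else if even j then q else inverse q)
     = (if odd k then 1 else if even j then q else inverse q)"
    using q_nonzero by auto
  ultimately show ?case
    using 3 by (auto intro!: qcomm_add_r qcomm_sm_r)
qed auto

text \<open>The counterpart of \<open>t_continuant\<close> with the factors exchanged. The same two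
  continuants appear, but their ratio changes by q; this discrepancy later rules out
  nilpotency.\<close>

lemma continuant_t_adjacent:
  assumes "k < n"
  shows "continuant (Suc k) \<otimes> t (Suc k)
       = (if odd k then inverse q else 1) \<odot> (continuant (Suc (Suc k)) \<oplus> q \<odot> continuant k)"
proof (cases k)
  case 0
  then show ?thesis by simp
next
  case (Suc m)
  let ?a = "t (Suc m)" and ?b = "t (Suc (Suc m))" and ?u = "continuant (Suc m)" and ?v = "continuant m"
  define g where "g = (if even m then inverse q else 1)"
  have cu: "?u \<otimes> ?b = (q * g) \<odot> (?b \<otimes> ?u)"
    using qcomm_sym[OF _ _ _ qcomm_t_continuant_above[of "Suc m" "Suc (Suc m)"]] assms Suc q_nonzero
    by (auto simp: qcomm_def g_def split: if_splits)
  have cv: "?v \<otimes> ?b = g \<odot> (?b \<otimes> ?v)"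
    using qcomm_sym[OF _ _ _ qcomm_t_continuant_above[of "m" "Suc (Suc m)"]] assms Suc q_nonzero
    by (auto simp: qcomm_def g_def split: if_splits)
  have rel: "?b \<otimes> ?a = q \<odot> (?a \<otimes> ?b) \<oplus> (1 - q) \<odot> \<one>"
    using t_adjacent[of "Suc m"] assms Suc by simp
  have "?b \<otimes> (?a \<otimes> ?u) = (?b \<otimes> ?a) \<otimes> ?u" by (simp add: m_assoc)
  also have "\<dots> = q \<odot> (?a \<otimes> (?b \<otimes> ?u)) \<oplus> (1 - q) \<odot> ?u"
    by (simp add: rel l_distr m_assoc)
  finally have bau: "?b \<otimes> (?a \<otimes> ?u) = q \<odot> (?a \<otimes> (?b \<otimes> ?u)) \<oplus> (1 - q) \<odot> ?u" .
  have "continuant (Suc k) \<otimes> t (Suc k) = (?a \<otimes> ?u \<oplus> (- 1) \<odot> ?v) \<otimes> ?b"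
    using Suc by simp
  also have "\<dots> = (q * g) \<odot> (?a \<otimes> (?b \<otimes> ?u)) \<oplus> (- g) \<odot> (?b \<otimes> ?v)"
    by (simp add: l_distr m_assoc cu cv mult.commute)
  finally have lhs: "continuant (Suc k) \<otimes> t (Suc k) = \<dots>" .
  have "continuant (Suc (Suc k)) \<oplus> q \<odot> continuant k = ?b \<otimes> (?a \<otimes> ?u \<oplus> (- 1) \<odot> ?v) \<oplus> (- 1) \<odot> ?u \<oplus> q \<odot> ?u"
    using Suc by simp
  also have "\<dots> = q \<odot> (?a \<otimes> (?b \<otimes> ?u)) \<oplus> ((- 1) \<odot> (?b \<otimes> ?v) \<oplus>
       ((1 - q) \<odot> ?u \<oplus> ((- 1) \<odot> ?u \<oplus> q \<odot> ?u)))"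
    by (simp add: r_distr bau a_ac)
  \<comment> \<open>The constant 1 - q of the adjacent relation is exactly what makes the multiples
    of \<open>?u\<close> cancel.\<close>
  also have "(1 - q) \<odot> ?u \<oplus> ((- 1) \<odot> ?u \<oplus> q \<odot> ?u) = \<zero>"
    by (simp add: sm_l_distr[symmetric])
  finally have "continuant (Suc (Suc k)) \<oplus> q \<odot> continuant k
     = q \<odot> (?a \<otimes> (?b \<otimes> ?u)) \<oplus> (- 1) \<odot> (?b \<otimes> ?v)" by simp
  moreover have "(if odd k then inverse q else 1) = g"
    using Suc by (simp add: g_def)
  ultimately show ?thesis
    using lhs by (simp add: sm_r_distr mult.commute)
qed

text \<open>W_j commutes up to powers of q with the generators it is built from, so the last one is
  normal. In the recursion for W_{j+2} the new generator t_{j+1} is far from t_k, adjacent to it, or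
  equal to it.\<close>

lemma qcomm_continuant_t_below:
  "1 \<le> k \<Longrightarrow> k < j \<Longrightarrow> j \<le> Suc n \<Longrightarrow>
     qcomm (if even j then 1 else if odd k then q else inverse q) (continuant j) (t k)"
proof (induction j rule: continuant.induct)
  case (3 j)
  note prems = 3
  consider "k < j" | "k = j" | "k = Suc j" using 3 by linarith
  then show ?case
  proof cases
    case 1
    have "qcomm ((if even (k + Suc j) then inverse q else q) *
       (if even (Suc j) then 1 else if odd k then q else inverse q)) (t (Suc j) \<otimes> continuant (Suc j)) (t k)"
      by (intro qcomm_mult_l t_far 3(1)) (use 1 3 in auto)
    moreover have "(if even (k + Suc j) then inverse q else q) *
       (if even (Suc j) then 1 else if odd k then q else inverse q)
       = (if even j then 1 else if odd k then q else inverse q)"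
      using q_nonzero by auto
    ultimately show ?thesis
      using 1 3 by (auto intro!: qcomm_add_l qcomm_sm_l)
  next
    case 2
    \<comment> \<open>The new generator is adjacent to t_k = t_j. Induction handles W_{j+1} and
      \<open>continuant_t_adjacent\<close> handles W_j.\<close>
    obtain m where m: "j = Suc m" using 2 3 by (cases j) auto
    let ?a = "t (Suc m)" and ?b = "t (Suc (Suc m))"
      and ?u = "continuant (Suc m)" and ?v = "continuant m" and ?w = "continuant (Suc (Suc m))"
    define g where "g = (if odd m then inverse q else 1)"
    have c1: "?w \<otimes> ?a = g \<odot> (?a \<otimes> ?w)"
      using 3(1) 2 3 m by (auto simp: qcomm_def g_def)
    have c2: "?u \<otimes> ?a = g \<odot> (?w \<oplus> q \<odot> ?v)"
      using continuant_t_adjacent[of m] 2 3 m by (simp add: g_def)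
    have rel: "?b \<otimes> ?a = q \<odot> (?a \<otimes> ?b) \<oplus> (1 - q) \<odot> \<one>"
      using t_adjacent[of "Suc m"] 2 3 m by simp
    have "?b \<otimes> (?a \<otimes> ?w) = (?b \<otimes> ?a) \<otimes> ?w" by (simp add: m_assoc del: continuant.simps)
    also have "\<dots> = q \<odot> (?a \<otimes> (?b \<otimes> ?w)) \<oplus> (1 - q) \<odot> ?w"
      by (simp add: rel l_distr m_assoc del: continuant.simps)
    finally have baw: "?b \<otimes> (?a \<otimes> ?w) = q \<odot> (?a \<otimes> (?b \<otimes> ?w)) \<oplus> (1 - q) \<odot> ?w" .
    have "continuant (Suc (Suc j)) \<otimes> t k = (?b \<otimes> ?w \<oplus> (- 1) \<odot> ?u) \<otimes> ?a"
      using m 2 by simp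
    also have "\<dots> = g \<odot> (?b \<otimes> (?a \<otimes> ?w) \<oplus> (- 1) \<odot> (?w \<oplus> q \<odot> ?v))"
      by (simp add: l_distr m_assoc c1 c2 sm_r_distr del: continuant.simps)
    also have "?b \<otimes> (?a \<otimes> ?w) \<oplus> (- 1) \<odot> (?w \<oplus> q \<odot> ?v)
        = q \<odot> (?a \<otimes> (?b \<otimes> ?w)) \<oplus> ((1 - q) \<odot> ?w \<oplus> (- 1) \<odot> ?w) \<oplus> (- q) \<odot> ?v"
      by (simp add: baw sm_r_distr a_assoc del: continuant.simps)
    \<comment> \<open>The constant 1 - q changes the coefficient of W_{j+1} from -1 to -q, which
      matches that of W_{j-1}.\<close>
    also have "(1 - q) \<odot> ?w \<oplus> (- 1) \<odot> ?w = (- q) \<odot> ?w"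
      by (simp add: sm_l_distr[symmetric] del: continuant.simps)
    also have "q \<odot> (?a \<otimes> (?b \<otimes> ?w)) \<oplus> (- q) \<odot> ?w \<oplus> (- q) \<odot> ?v
        = q \<odot> (?a \<otimes> (?b \<otimes> ?w) \<oplus> (- 1) \<odot> (?w \<oplus> ?v))"
      by (simp add: sm_r_distr a_assoc del: continuant.simps)
    \<comment> \<open>Since W_{j+1} + W_{j-1} = t_j W_j, the generator t_j factors out on the
      left.\<close>
    also have "?a \<otimes> (?b \<otimes> ?w) \<oplus> (- 1) \<odot> (?w \<oplus> ?v) = t k \<otimes> continuant (Suc (Suc j))"
      using m 2 by (simp add: r_distr t_continuant[symmetric] del: continuant.simps(3)) (simp add: r_distr)
    finally show ?thesis
      using m 2 q_nonzero by (simp add: qcomm_def g_def split: if_splits del: continuant.simps)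
  next
    case 3
    \<comment> \<open>Now t_k = t_{j+1} itself. Moving it past W_{j+1} and W_j yields opposite
      multiples of t_{j+1} W_j.\<close>
    let ?b = "t (Suc j)" and ?u = "continuant (Suc j)" and ?v = "continuant j" and ?w = "continuant (Suc (Suc j))"
    define g where "g = (if odd j then inverse q else 1)"
    have c1: "?u \<otimes> ?b = g \<odot> (?w \<oplus> q \<odot> ?v)"
      using continuant_t_adjacent[of j] prems 3 by (simp add: g_def)
    have "qcomm (inverse (if odd j then 1 else inverse q)) ?v ?b"
      using qcomm_sym[OF _ _ _ qcomm_t_continuant_above[of j "Suc j"]] prems q_nonzero
      by (auto split: if_splits)
    then have c2: "?v \<otimes> ?b = (g * q) \<odot> (?b \<otimes> ?v)"
      using q_nonzero by (auto simp: qcomm_def g_def split: if_splits)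
    have "?w \<otimes> ?b = (?b \<otimes> ?u \<oplus> (- 1) \<odot> ?v) \<otimes> ?b" by simp
    also have "\<dots> = g \<odot> (?b \<otimes> ?w) \<oplus> ((g * q) \<odot> (?b \<otimes> ?v) \<oplus> (- (g * q)) \<odot> (?b \<otimes> ?v))"
      by (simp add: l_distr m_assoc c1 c2 r_distr sm_r_distr a_assoc del: continuant.simps)
    also have "(g * q) \<odot> (?b \<otimes> ?v) \<oplus> (- (g * q)) \<odot> (?b \<otimes> ?v) = \<zero>"
      by (simp add: sm_l_distr[symmetric])
    finally show ?thesis
      using prems 3 by (simp add: qcomm_def g_def split: if_splits del: continuant.simps)
  qed
qed auto

text \<open>W_k is a polynomial in generators below j, each of which commutes with W_j up to a power
  of q; the powers agree on both summands of the recursion.\<close>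

lemma qcomm_continuant_continuant:
  "k \<le> j \<Longrightarrow> j \<le> Suc n \<Longrightarrow> qcomm (if odd j \<and> even k then q else 1) (continuant j) (continuant k)"
proof (induction k rule: continuant.induct)
  case (3 k)
  have "qcomm ((if even j then 1 else if odd (Suc k) then q else inverse q) *
      (if odd j \<and> even (Suc k) then q else 1)) (continuant j) (t (Suc k) \<otimes> continuant (Suc k))"
    by (intro qcomm_mult_r 3(1) qcomm_continuant_t_below) (use 3 in auto)
  moreover have "(if even j then 1 else if odd (Suc k) then q else inverse q) *
      (if odd j \<and> even (Suc k) then q else 1) = (if odd j \<and> even k then q else 1)"
    using q_nonzero by auto
  ultimately show ?case
    using 3 by (auto intro!: qcomm_add_r qcomm_sm_r)
qed auto

end

context L_relations
begin

sublocale skew_generated R sm n t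
proof
  fix i j :: nat assume ij: "1 \<le> j" "j \<le> i" "i < n"
  show "\<exists>c d. c \<noteq> 0 \<and> t j \<otimes> t (Suc i) = c \<odot> (t (Suc i) \<otimes> t j) \<oplus> d \<odot> \<one>"
  proof (cases "j = i")
    case True
    \<comment> \<open>The adjacent relation is solved for the opposite order of the factors.\<close>
    have "t i \<otimes> t (Suc i) = inverse q \<odot> (q \<odot> (t i \<otimes> t (Suc i)) \<oplus> (1 - q) \<odot> \<one> \<oplus> (q - 1) \<odot> \<one>)"
      using q_nonzero by (simp add: a_assoc flip: sm_l_distr)
    also have "\<dots> = inverse q \<odot> (t (Suc i) \<otimes> t i) \<oplus> (inverse q * (q - 1)) \<odot> \<one>"
      using t_adjacent[of i] ij True by (simp add: sm_r_distr)
    finally show ?thesis using True q_nonzero by (metis nonzero_imp_inverse_nonzero)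
  next
    case False
    let ?c = "if even (j + Suc i) then inverse q else q"
    have "?c \<noteq> 0" using q_nonzero by simp
    have "qcomm ?c (t (Suc i)) (t j)"
      by (rule t_far) (use ij False in auto)
    then have "qcomm (inverse ?c) (t j) (t (Suc i))"
      using qcomm_sym[OF _ _ \<open>?c \<noteq> 0\<close>] by blast
    then have "t j \<otimes> t (Suc i) = inverse ?c \<odot> (t (Suc i) \<otimes> t j) \<oplus> 0 \<odot> \<one>"
      by (simp add: qcomm_def)
    then show ?thesis using \<open>?c \<noteq> 0\<close> nonzero_imp_inverse_nonzero by blast
  qed
qed auto

end

locale prime_L_relations = L_relations R sm n q t
  for R (structure) and sm :: "'k::field \<Rightarrow> 'a \<Rightarrow> 'a" (infixr "\<odot>" 75)
    and n :: nat and q :: 'k and t :: "nat \<Rightarrow> 'a" +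
  assumes q_not_root: "\<And>m::nat. m \<ge> 1 \<Longrightarrow> q ^ m \<noteq> 1"
    and generated: "carrier R \<subseteq> subalg n"
    and nontrivial: "\<one> \<noteq> \<zero>"
    and prime: "a \<in> carrier R \<Longrightarrow> b \<in> carrier R \<Longrightarrow>
        (\<And>r. r \<in> carrier R \<Longrightarrow> a \<otimes> (r \<otimes> b) = \<zero>) \<Longrightarrow> a = \<zero> \<or> b = \<zero>"
begin

section \<open>Right regularity of the continuants\<close>

definition right_regular :: "'a \<Rightarrow> bool" where
  "right_regular a \<longleftrightarrow> (\<forall>r \<in> carrier R. r \<otimes> a = \<zero> \<longrightarrow> r = \<zero>)"

text \<open>The elements killed on the right by the m-th power of w form an ascending chain of left
  ideals.\<close>

lemma right_annihilator_chain:
  assumes w: "w \<in> carrier R"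
  obtains N :: nat where "\<And>r m. r \<in> carrier R \<Longrightarrow> r \<otimes> w [^] (m::nat) = \<zero> \<Longrightarrow> r \<otimes> w [^] N = \<zero>"
proof -
  define J where "J m = {r \<in> carrier R. r \<otimes> w [^] m = \<zero>}" for m :: nat
  have "left_submodule n (J m)" for m
    unfolding left_submodule_def J_def using w generated
    by (auto simp: l_distr m_assoc)
  moreover have step: "J m \<subseteq> J (Suc m)" for m
    using w by (auto simp: J_def m_assoc[symmetric])
  ultimately obtain N where N: "\<forall>k\<ge>N. J k = J N"
    using left_noetherian_le[of n] unfolding left_noetherian_def by blast
  have "r \<in> J N" if "r \<in> J m" for r m
  proof (cases "m \<le> N")
    case True
    then show ?thesis using lift_Suc_mono_le[of J, OF step] that by blast
  next
    case False
    then show ?thesis using N that by (metis nat_le_linear)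
  qed
  then show thesis by (intro that[of N]) (auto simp: J_def)
qed

text \<open>By \<open>ore\<close> the set \<open>I\<close> of elements killed by some power of w is
  stable under right multiplication by the generators. One exponent N serves all of
  \<open>I\<close>, so r w = 0 implies r R w^N = 0, and primeness leaves r = 0.\<close>

lemma right_regularI:
  assumes w: "w \<in> carrier R"
    and ore: "\<And>j (m::nat). 1 \<le> j \<Longrightarrow> j \<le> n \<Longrightarrow> \<exists>s \<in> carrier R. \<exists>p::nat. t j \<otimes> w [^] p = w [^] m \<otimes> s"
    and not_nilpotent: "\<And>m::nat. w [^] m \<noteq> \<zero>"
  shows "right_regular w"
proof -
  define I where "I = {r \<in> carrier R. \<exists>m::nat. r \<otimes> w [^] m = \<zero>}"
  have mult_pow: "r \<otimes> w [^] (m + k) = \<zero>" if "r \<in> carrier R" "r \<otimes> w [^] m = \<zero>" for r and m k :: nat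
  proof -
    have "r \<otimes> w [^] (m + k) = (r \<otimes> w [^] m) \<otimes> w [^] k"
      using that(1) w by (simp add: m_assoc nat_pow_mult)
    then show ?thesis using that w by simp
  qed
  have I_t: "r \<otimes> t j \<in> I" if r: "r \<in> I" and j: "1 \<le> j" "j \<le> n" for r j
  proof -
    obtain m :: nat where m: "r \<otimes> w [^] m = \<zero>" using r by (auto simp: I_def)
    obtain s and p :: nat where s: "s \<in> carrier R" "t j \<otimes> w [^] p = w [^] m \<otimes> s" using ore j by blast
    have rc: "r \<in> carrier R" using r by (simp add: I_def)
    have "(r \<otimes> t j) \<otimes> w [^] p = (r \<otimes> w [^] m) \<otimes> s"
      using rc w s by (simp add: m_assoc)
    also have "\<dots> = \<zero>" using m s by simp
    finally show ?thesis using rc by (auto simp: I_def)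
  qed
  have "r \<otimes> s \<in> I" if "s \<in> subalg n" "r \<in> I" for r s
    using that
  proof (induction arbitrary: r rule: subalg.induct)
    case one
    then show ?case by (auto simp: I_def)
  next
    case (sm s c)
    then obtain m :: nat where "r \<otimes> s \<otimes> w [^] m = \<zero>" by (fastforce simp: I_def)
    then have "r \<otimes> c \<odot> s \<otimes> w [^] m = \<zero>" using sm subalg_closed w by (simp add: I_def)
    then show ?case using sm subalg_closed by (auto simp: I_def)
  next
    case (add s s')
    then obtain m k :: nat where "r \<otimes> s \<otimes> w [^] m = \<zero>" "r \<otimes> s' \<otimes> w [^] k = \<zero>"
      by (fastforce simp: I_def)
    then have "r \<otimes> s \<otimes> w [^] (m + k) = \<zero>" "r \<otimes> s' \<otimes> w [^] (m + k) = \<zero>"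
      using mult_pow[of "r \<otimes> s" m k] mult_pow[of "r \<otimes> s'" k m] add subalg_closed
      by (auto simp: I_def add.commute)
    then have "r \<otimes> (s \<oplus> s') \<otimes> w [^] (m + k) = \<zero>"
      using add subalg_closed w by (simp add: I_def r_distr l_distr)
    then show ?case using add subalg_closed by (auto simp: I_def)
  next
    case (gen s j)
    then have "(r \<otimes> t j) \<otimes> s \<in> I" using I_t by blast
    then show ?case using gen subalg_closed by (simp add: I_def m_assoc)
  qed
  then have I_right: "r \<otimes> s \<in> I" if "r \<in> I" "s \<in> carrier R" for r s
    using that generated by blast
  obtain N :: nat where N: "\<And>r m. r \<in> carrier R \<Longrightarrow> r \<otimes> w [^] (m::nat) = \<zero> \<Longrightarrow> r \<otimes> w [^] N = \<zero>"
    using right_annihilator_chain[OF w] by blast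
  show ?thesis
    unfolding right_regular_def
  proof (intro ballI impI)
    fix r assume r: "r \<in> carrier R" "r \<otimes> w = \<zero>"
    have "r \<otimes> w [^] (1::nat) = \<zero>" using r w by simp
    then have "r \<in> I" using r(1) unfolding I_def by blast
    have "r = \<zero> \<or> w [^] N = \<zero>"
    proof (rule prime)
      fix s assume s: "s \<in> carrier R"
      then obtain m :: nat where "r \<otimes> s \<otimes> w [^] m = \<zero>"
        using I_right[OF \<open>r \<in> I\<close>] by (auto simp: I_def)
      then have "r \<otimes> s \<otimes> w [^] N = \<zero>" using N r(1) s by blast
      then show "r \<otimes> (s \<otimes> w [^] N) = \<zero>" using r(1) s w by (simp add: m_assoc)
    qed (use r w in auto)
    then show "r = \<zero>" using not_nilpotent by blast
  qed
qed

text \<open>If w^{m+1} = 0 for w = W_{k+2}, then multiplying by t_{k+2} on either side gives two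
  linear equations for w^m W_{k+3} and w^m W_{k+1}. They are independent, so w^m W_{k+1} = 0, and
  regularity of W_{k+1} gives w^m = 0.\<close>

lemma continuant_pow_nonzero:
  assumes k: "Suc k < n" and reg: "right_regular (continuant (Suc k))"
  shows "continuant (Suc (Suc k)) [^] (m::nat) \<noteq> \<zero>"
proof (induction m)
  case 0
  then show ?case using nontrivial by simp
next
  case (Suc m)
  let ?t = "t (Suc (Suc k))" and ?w = "continuant (Suc (Suc k))"
    and ?a = "continuant (Suc (Suc (Suc k)))" and ?b = "continuant (Suc k)"
  define \<alpha> where "\<alpha> = (if even k then q else 1)"
  define \<beta> where "\<beta> = (if odd k then inverse q else 1)"
  have a: "?a \<otimes> ?w [^] m = \<alpha> ^ m \<odot> (?w [^] m \<otimes> ?a)"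
    by (rule qcomm_pow)
       (use qcomm_continuant_continuant[of "Suc (Suc k)" "Suc (Suc (Suc k))"] k in \<open>auto simp: \<alpha>_def simp del: continuant.simps\<close>)
  have b: "?b \<otimes> ?w [^] m = \<beta> ^ m \<odot> (?w [^] m \<otimes> ?b)"
    by (rule qcomm_pow)
       (use qcomm_sym[OF _ _ _ qcomm_continuant_continuant[of "Suc k" "Suc (Suc k)"]] k q_nonzero
         in \<open>auto simp: \<beta>_def simp del: continuant.simps split: if_splits\<close>)
  define c where "c = (if odd (Suc k) then inverse q else 1)"
  have wt: "?w \<otimes> ?t = c \<odot> (?a \<oplus> q \<odot> ?b)"
    using continuant_t_adjacent[of "Suc k"] k by (simp add: c_def del: continuant.simps)
  have tw: "?t \<otimes> ?w = ?a \<oplus> ?b" by (rule t_continuant)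
  show ?case
  proof
    assume zero: "?w [^] Suc m = \<zero>"
    have "c \<odot> (?w [^] m \<otimes> (?a \<oplus> q \<odot> ?b)) = ?w [^] m \<otimes> (?w \<otimes> ?t)"
      by (simp add: wt r_distr del: continuant.simps)
    also have "\<dots> = ?w [^] Suc m \<otimes> ?t" by (simp add: m_assoc del: continuant.simps)
    also have "\<dots> = \<zero>" by (simp only: zero l_null t_closed)
    finally have "?w [^] m \<otimes> (?a \<oplus> q \<odot> ?b) = \<zero>"
      using sm_eq_zero_iff q_nonzero by (auto simp: c_def simp del: continuant.simps split: if_splits)
    then have e1: "?w [^] m \<otimes> ?a \<oplus> q \<odot> (?w [^] m \<otimes> ?b) = \<zero>"
      by (simp add: r_distr del: continuant.simps)
    have "\<alpha> ^ m \<odot> (?w [^] m \<otimes> ?a) \<oplus> \<beta> ^ m \<odot> (?w [^] m \<otimes> ?b) = (?t \<otimes> ?w) \<otimes> ?w [^] m"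
      by (simp add: tw l_distr a b del: continuant.simps)
    also have "\<dots> = ?t \<otimes> ?w [^] Suc m"
      by (simp add: m_assoc pow_comm_self del: continuant.simps)
    also have "\<dots> = \<zero>" by (simp only: zero r_null t_closed)
    finally have e2: "\<alpha> ^ m \<odot> (?w [^] m \<otimes> ?a) \<oplus> \<beta> ^ m \<odot> (?w [^] m \<otimes> ?b) = \<zero>" .
    let ?A = "?w [^] m \<otimes> ?a" and ?B = "?w [^] m \<otimes> ?b"
    \<comment> \<open>Eliminate \<open>?A\<close> from the equations \<open>e1\<close> and
      \<open>e2\<close>.\<close>
    have "(\<beta> ^ m - \<alpha> ^ m * q) \<odot> ?B = \<beta> ^ m \<odot> ?B \<oplus> (- (\<alpha> ^ m * q)) \<odot> ?B"
      by (simp add: diff_conv_add_uminus sm_l_distr del: continuant.simps add_uminus_conv_diff)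
    also have "\<dots> = \<beta> ^ m \<odot> ?B \<oplus> (- (\<alpha> ^ m * q)) \<odot> ?B \<oplus> (\<alpha> ^ m \<odot> ?A \<oplus> (- (\<alpha> ^ m)) \<odot> ?A)"
      by (simp flip: sm_l_distr del: continuant.simps)
    also have "\<dots> = (\<alpha> ^ m \<odot> ?A \<oplus> \<beta> ^ m \<odot> ?B) \<oplus> (- (\<alpha> ^ m)) \<odot> (?A \<oplus> q \<odot> ?B)"
      by (simp add: sm_r_distr a_ac del: continuant.simps)
    also have "\<dots> = \<zero>" by (simp add: e1 e2 del: continuant.simps)
    finally have "(\<beta> ^ m - \<alpha> ^ m * q) \<odot> ?B = \<zero>" .
    \<comment> \<open>For either parity of k this determinant is a unit times 1 - q^{m+1}.\<close>
    moreover have "\<beta> ^ m - \<alpha> ^ m * q \<noteq> 0"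
      using q_not_root[of "Suc m"] q_nonzero
      by (auto simp: \<alpha>_def \<beta>_def field_simps)
    ultimately have "?B = \<zero>" using sm_eq_zero_iff by (simp del: continuant.simps)
    then show False using Suc reg unfolding right_regular_def by (simp del: continuant.simps)
  qed
qed

lemma continuant_right_regular: "k < n \<Longrightarrow> right_regular (continuant (Suc k))"
proof (induction k)
  case 0
  then show ?case by (simp add: right_regular_def)
next
  case (Suc k)
  let ?w = "continuant (Suc (Suc k))"
  show ?case
  proof (rule right_regularI)
    fix j m :: nat assume j: "1 \<le> j" "j \<le> n"
    consider "j < Suc (Suc k)" | "j = Suc (Suc k)" | "Suc (Suc k) < j" by linarith
    then show "\<exists>s \<in> carrier R. \<exists>p::nat. t j \<otimes> ?w [^] p = ?w [^] m \<otimes> s"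
    proof cases
      case 2
      let ?s = "continuant (Suc (Suc (Suc k))) \<oplus> continuant (Suc k)"
      let ?c = "if even k then q else 1" and ?d = "if odd k then inverse q else 1"
      have a: "continuant (Suc (Suc (Suc k))) \<otimes> ?w [^] m = ?c ^ m \<odot> (?w [^] m \<otimes> continuant (Suc (Suc (Suc k))))"
        by (rule qcomm_pow)
           (use qcomm_continuant_continuant[of "Suc (Suc k)" "Suc (Suc (Suc k))"] Suc in \<open>auto simp del: continuant.simps\<close>)
      have b: "continuant (Suc k) \<otimes> ?w [^] m = ?d ^ m \<odot> (?w [^] m \<otimes> continuant (Suc k))"
        by (rule qcomm_pow)
           (use qcomm_sym[OF _ _ _ qcomm_continuant_continuant[of "Suc k" "Suc (Suc k)"]] Suc q_nonzero
             in \<open>auto simp del: continuant.simps split: if_splits\<close>)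
      \<comment> \<open>The witness is p = m + 1: one factor w turns t_j into W_{j+1} + W_{j-1}, and
        both summands commute with w up to scalars.\<close>
      have "t j \<otimes> ?w [^] Suc m = (t j \<otimes> ?w) \<otimes> ?w [^] m"
        by (simp add: m_assoc pow_comm_self del: continuant.simps)
      also have "\<dots> = ?w [^] m \<otimes> (?c ^ m \<odot> continuant (Suc (Suc (Suc k))) \<oplus> ?d ^ m \<odot> continuant (Suc k))"
        using 2 by (simp only: t_continuant l_distr a b continuant_closed nat_pow_closed r_distr sm_closed sm_mult_r)
      finally show ?thesis by (metis continuant_closed sm_closed a_closed)
    next
      case 1
      let ?c = "if even k then 1 else if odd j then q else inverse q"
      have "qcomm ?c ?w (t j)"
        using qcomm_continuant_t_below[of j "Suc (Suc k)"] j 1 Suc.prems by (simp del: continuant.simps)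
      then have "qcomm (inverse ?c) (t j) ?w" using q_nonzero by (intro qcomm_sym) auto
      then have "t j \<otimes> ?w [^] m = ?w [^] m \<otimes> ((inverse ?c) ^ m \<odot> t j)"
        using qcomm_pow[of "t j" _ ?w m] by (simp del: continuant.simps)
      then show ?thesis by blast
    next
      case 3
      then obtain c where "qcomm c (t j) ?w" using qcomm_t_continuant_above j(2) by blast
      then have "t j \<otimes> ?w [^] m = ?w [^] m \<otimes> (c ^ m \<odot> t j)"
        using qcomm_pow[of "t j" _ ?w m] by (simp del: continuant.simps)
      then show ?thesis by blast
    qed
  qed (use continuant_pow_nonzero Suc in auto)
qed

section \<open>The chart formed by the nonzero continuants\<close>

definition frame :: "nat set" where
  "frame = {k. 1 \<le> k \<and> k \<le> Suc n \<and> continuant k \<noteq> \<zero>}"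

definition continuant_exponent :: "nat \<Rightarrow> nat \<Rightarrow> int" where
  "continuant_exponent i j = (if j \<le> i then (if odd i \<and> even j then 1 else 0)
                     else (if odd j \<and> even i then - 1 else 0))"

text \<open>There is no t_{n+1} to compare with, but this continuant is normal: r W_{n+1} = 0
  implies r R W_{n+1} = 0.\<close>

lemma continuant_last_right_regular:
  assumes "continuant (Suc n) \<noteq> \<zero>"
  shows "right_regular (continuant (Suc n))"
  unfolding right_regular_def
proof (intro ballI impI)
  fix r assume r: "r \<in> carrier R" "r \<otimes> continuant (Suc n) = \<zero>"
  have shift: "r \<otimes> (s \<otimes> continuant (Suc n)) = \<zero>" if "s \<in> subalg n" "r \<in> carrier R" "r \<otimes> continuant (Suc n) = \<zero>" for r s
    using that
  proof (induction arbitrary: r rule: subalg.induct)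
    case one
    then show ?case by simp
  next
    case (sm s c)
    then show ?case using subalg_closed by simp
  next
    case (add s s')
    then show ?case using subalg_closed by (simp add: l_distr r_distr)
  next
    case (gen s j)
    let ?c = "if even (Suc n) then 1 else if odd j then q else inverse q"
    have "qcomm (inverse ?c) (t j) (continuant (Suc n))"
      using qcomm_continuant_t_below[of j "Suc n"] gen.hyps q_nonzero by (intro qcomm_sym) auto
    then have "(r \<otimes> t j) \<otimes> continuant (Suc n) = inverse ?c \<odot> ((r \<otimes> continuant (Suc n)) \<otimes> t j)"
      using gen.prems(1) by (simp add: m_assoc qcommD)
    then have "(r \<otimes> t j) \<otimes> continuant (Suc n) = \<zero>" by (simp add: gen.prems)
    then have "(r \<otimes> t j) \<otimes> (s \<otimes> continuant (Suc n)) = \<zero>" using gen by simp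
    then show ?case using gen subalg_closed by (simp add: m_assoc)
  qed
  have "r = \<zero> \<or> continuant (Suc n) = \<zero>"
    by (rule prime) (use shift r generated in blast)+
  then show "r = \<zero>" using assms by blast
qed

sublocale quantum_torus_chart R sm q frame continuant continuant_exponent
proof
  fix i j assume ij: "i \<in> frame" "j \<in> frame"
  show "qcomm (q powi continuant_exponent i j) (continuant i) (continuant j)"
  proof (cases "j \<le> i")
    case True
    then show ?thesis using qcomm_continuant_continuant[of j i] ij by (auto simp: continuant_exponent_def frame_def)
  next
    case False
    then have "qcomm (if odd j \<and> even i then q else 1) (continuant j) (continuant i)"
      using ij by (intro qcomm_continuant_continuant) (auto simp: frame_def)
    then have "qcomm (inverse (if odd j \<and> even i then q else 1)) (continuant i) (continuant j)"
      using q_nonzero by (intro qcomm_sym) auto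
    then show ?thesis using False by (auto simp: continuant_exponent_def split: if_splits)
  qed
next
  fix r j assume *: "j \<in> frame" "r \<in> carrier R" "r \<otimes> continuant j = \<zero>"
  then have "right_regular (continuant j)"
    using continuant_right_regular[of "j - 1"] continuant_last_right_regular
    by (cases "j = Suc n") (auto simp: frame_def)
  then show "r = \<zero>" using * by (simp add: right_regular_def)
qed (auto simp: q_nonzero q_not_root)

text \<open>A right regular element is nonzero in a nontrivial ring, so among 1, ..., n+1 only n+1
  can be missing from \<open>frame\<close>.\<close>

lemma continuant_frame: "1 \<le> j \<Longrightarrow> j \<le> n \<Longrightarrow> j \<in> frame"
  using continuant_right_regular[of "j - 1"] nontrivial by (auto simp: frame_def right_regular_def)

text \<open>The recursion also meets W_0 and a possibly vanishing W_{n+1}, which are outside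
  \<open>frame\<close>; the empty sum represents them.\<close>

lemma continuant_ev: "k \<le> Suc n \<Longrightarrow> \<exists>xs. valid xs \<and> ev xs = continuant k"
proof (cases "continuant k = \<zero>")
  case True
  then show ?thesis by (intro exI[of _ "[]"]) simp
next
  case False
  assume "k \<le> Suc n"
  with False have "k \<in> frame" by (cases k) (auto simp: frame_def)
  then show ?thesis by (intro exI[of _ "[(1, [k])]"]) simp
qed

text \<open>A new letter t_j is absorbed by one more factor W_j, because t_j W_j is a sum of two
  continuants.\<close>

lemma frame_chart:
  "r \<in> subalg n \<Longrightarrow> \<exists>ks xs. ks \<in> lists frame \<and> valid xs \<and> r \<otimes> mon ks = ev xs"
proof (induction rule: subalg.induct)
  case one
  show ?case by (intro exI[of _ "[]"] exI[of _ "[(1, [])]"]) simp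
next
  case (sm r c)
  then obtain ks xs where *: "ks \<in> lists frame" "valid xs" "r \<otimes> mon ks = ev xs" by blast
  have "c \<odot> r \<otimes> mon ks = ev (twist (\<lambda>_. c) xs)"
    using sm.hyps subalg_closed * by (simp add: ev_twist_const)
  then show ?case using * by (metis valid_twist)
next
  case (add r s)
  then obtain ks xs ls ys where *: "ks \<in> lists frame" "valid xs" "r \<otimes> mon ks = ev xs"
    "ls \<in> lists frame" "valid ys" "s \<otimes> mon ls = ev ys" by blast
  \<comment> \<open>Common denominator: \<open>mon ks\<close> is moved behind \<open>mon ls\<close>,
    so that s meets its own denominator first.\<close>
  obtain zs where z: "valid zs" "mon ks \<otimes> mon ls = mon ls \<otimes> ev zs"
    using ev_mon[of "[(1, ks)]" ls] * by auto
  have [simp]: "r \<in> carrier R" "s \<in> carrier R" using add subalg_closed by auto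
  have "r \<otimes> mon (ks @ ls) = ev xs \<otimes> mon ls"
    by (simp add: mon_append *(3)[symmetric] m_assoc)
  moreover have "s \<otimes> mon (ks @ ls) = ev ys \<otimes> ev zs"
    by (simp add: mon_append *(6)[symmetric] z(2) m_assoc)
  ultimately have "(r \<oplus> s) \<otimes> mon (ks @ ls) = ev (times xs [(1, ls)] @ times ys zs)"
    by (simp add: l_distr ev_append ev_times)
  moreover have "valid (times xs [(1, ls)] @ times ys zs)" using * z by simp
  ultimately show ?case using * by (metis append_in_lists_conv)
next
  case (gen r j)
  then obtain ks xs where *: "ks \<in> lists frame" "valid xs" "r \<otimes> mon ks = ev xs" by blast
  have [simp]: "r \<in> carrier R" using gen subalg_closed by auto
  have j: "j \<in> frame" using continuant_frame gen by blast
  obtain i where i: "j = Suc i" using gen by (cases j) auto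
  let ?ys = "twist (\<lambda>ks. q powi wt j ks) xs"
  obtain us ws where w: "valid us" "ev us = continuant (Suc j)" "valid ws" "ev ws = continuant i"
    using continuant_ev[of "Suc j"] continuant_ev[of i] gen i by auto
  \<comment> \<open>The extra W_j is moved left through \<open>ev xs\<close> until it stands next to
    t_j.\<close>
  have "(t j \<otimes> r) \<otimes> mon (ks @ [j]) = t j \<otimes> ((r \<otimes> mon ks) \<otimes> continuant j)"
    by (simp add: mon_append m_assoc)
  also have "\<dots> = (t j \<otimes> continuant j) \<otimes> ev ?ys"
    using ev_v[OF *(2) j] by (simp add: *(3) m_assoc)
  also have "\<dots> = ev (times (us @ ws) ?ys)"
    using t_continuant[of i] w i by (simp add: ev_times ev_append del: continuant.simps)
  finally have "(t j \<otimes> r) \<otimes> mon (ks @ [j]) = ev (times (us @ ws) ?ys)" .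
  moreover have "valid (times (us @ ws) ?ys)" using w * by simp
  moreover have "ks @ [j] \<in> lists frame" using * j by simp
  ultimately show ?case by blast
qed

sublocale prime_quantum_torus_chart R sm q frame continuant continuant_exponent
proof
  show "a = \<zero> \<or> b = \<zero>"
    if "a \<in> carrier R" "b \<in> carrier R" "\<And>r. r \<in> carrier R \<Longrightarrow> a \<otimes> (r \<otimes> b) = \<zero>" for a b
    using prime that by blast
  show "\<exists>ks xs. ks \<in> lists frame \<and> valid xs \<and> r \<otimes> mon ks = ev xs" if "r \<in> carrier R" for r
    using frame_chart generated that by blast
qed

end

section \<open>Prime ideals of the algebra \<open>L\<^sub>n\<^sup>q\<close>\<close>

lemma (in ideal) rcos_eq_zero_iff:
  assumes "a \<in> carrier R"
  shows "I +> a = \<zero>\<^bsub>R Quot I\<^esub> \<longleftrightarrow> a \<in> I"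
  using assms a_rcos_const a_rcos_self by (auto simp: FactRing_def)

lemma carrier_FactRing: "carrier (R Quot I) = (\<lambda>a. I +>\<^bsub>R\<^esub> a) ` carrier R"
  by (auto simp: FactRing_def A_RCOSETS_def')

text \<open>Two annihilator arguments pass from elements to ideals. The y with a R y inside P form
  an ideal containing b; the x that send \<open>Idl {b}\<close> into P form an ideal containing
  a.\<close>

lemma (in ring) nc_prime_ideal_elementwise:
  assumes P: "nc_prime_ideal P R" and a: "a \<in> carrier R" and b: "b \<in> carrier R"
    and ab: "\<And>r. r \<in> carrier R \<Longrightarrow> a \<otimes> (r \<otimes> b) \<in> P"
  shows "a \<in> P \<or> b \<in> P"
proof -
  interpret P: ideal P R using P by (simp add: nc_prime_ideal_def)
  have iA: "ideal (Idl {a}) R" and iB: "ideal (Idl {b}) R"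
    using a b by (auto intro: genideal_ideal)
  interpret A: ideal "Idl {a}" R by (rule iA)
  interpret B: ideal "Idl {b}" R by (rule iB)
  have "ideal {y \<in> carrier R. \<forall>r \<in> carrier R. a \<otimes> (r \<otimes> y) \<in> P} R" (is "ideal ?J R")
  proof (rule idealI[OF ring_axioms])
    show "subgroup ?J (add_monoid R)"
      using a P.a_closed P.a_inv_closed P.zero_closed
      by (intro add.subgroupI) (auto simp: r_distr r_minus a_inv_def[symmetric])
  next
    fix y s assume *: "y \<in> ?J" "s \<in> carrier R"
    have "a \<otimes> (r \<otimes> (s \<otimes> y)) = a \<otimes> ((r \<otimes> s) \<otimes> y)" if "r \<in> carrier R" for r
      using that * a by (simp add: m_assoc)
    then show "s \<otimes> y \<in> ?J" using * by auto
    have "a \<otimes> (r \<otimes> (y \<otimes> s)) = (a \<otimes> (r \<otimes> y)) \<otimes> s" if "r \<in> carrier R" for r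
      using that * a by (simp add: m_assoc)
    then show "y \<otimes> s \<in> ?J" using * P.I_r_closed by auto
  qed
  then have J: "Idl {b} \<subseteq> ?J" using b ab by (intro genideal_minimal) auto
  have "ideal {x \<in> carrier R. \<forall>y \<in> Idl {b}. x \<otimes> y \<in> P} R" (is "ideal ?K R")
  proof (rule idealI[OF ring_axioms])
    show "subgroup ?K (add_monoid R)"
      using B.Icarr P.a_closed P.a_inv_closed P.zero_closed
      by (intro add.subgroupI) (auto simp: l_distr l_minus a_inv_def[symmetric])
  next
    fix x s assume *: "x \<in> ?K" "s \<in> carrier R"
    have "(s \<otimes> x) \<otimes> y = s \<otimes> (x \<otimes> y)" "(x \<otimes> s) \<otimes> y = x \<otimes> (s \<otimes> y)" if "y \<in> Idl {b}" for y
      using that * B.Icarr by (auto simp: m_assoc)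
    then show "s \<otimes> x \<in> ?K" "x \<otimes> s \<in> ?K"
      using * P.I_l_closed B.I_l_closed by auto
  qed
  moreover have "a \<otimes> y \<in> P" if "y \<in> Idl {b}" for y
    using J that one_closed B.Icarr by fastforce
  ultimately have K: "Idl {a} \<subseteq> ?K" using a by (intro genideal_minimal) auto
  have "s \<in> P" if "s \<in> (Idl {a}) \<cdot> (Idl {b})" for s
    using that by (induction rule: ideal_prod.induct) (use K in auto)
  then have "Idl {a} \<subseteq> P \<or> Idl {b} \<subseteq> P"
    using P iA iB unfolding nc_prime_ideal_def by blast
  then show ?thesis using genideal_self'[OF a] genideal_self'[OF b] by blast
qed

section \<open>Words in the free algebra\<close>

lemma free_gen_mult_word:
  "free_gen i \<otimes>\<^bsub>free_algebra n\<^esub> (\<lambda>u. if u = w then 1 else 0) = (\<lambda>u. if u = i # w then (1::'k::field) else 0)"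
proof
  fix u
  let ?f = "\<lambda>k. free_gen i (take k u) * (if drop k u = w then 1 else (0::'k))"
  show "(free_gen i \<otimes>\<^bsub>free_algebra n\<^esub> (\<lambda>u. if u = w then 1 else 0)) u = (if u = i # w then (1::'k) else 0)"
  proof (cases u)
    case Nil
    then show ?thesis by (simp add: free_algebra_def free_gen_def)
  next
    case (Cons a u')
    have "sum ?f {..length u} = sum ?f {1}"
      using Cons by (intro sum.mono_neutral_right) (auto simp: free_gen_def take_Cons' split: if_splits)
    then show ?thesis using Cons by (auto simp: free_algebra_def free_gen_def)
  qed
qed

text \<open>The cases mirror the rules of \<open>subalg\<close>. Words arise by prefixing letters,
  and general elements by induction on the support.\<close>

lemma free_algebra_induct [consumes 1, case_names one const add gen]:
  assumes f: "f \<in> carrier (free_algebra n)"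
    and one: "Q \<one>\<^bsub>free_algebra n\<^esub>"
    and const: "\<And>c f. f \<in> carrier (free_algebra n) \<Longrightarrow> Q f \<Longrightarrow> Q (free_const c \<otimes>\<^bsub>free_algebra n\<^esub> f)"
    and add: "\<And>f g. f \<in> carrier (free_algebra n) \<Longrightarrow> g \<in> carrier (free_algebra n) \<Longrightarrow>
                Q f \<Longrightarrow> Q g \<Longrightarrow> Q (f \<oplus>\<^bsub>free_algebra n\<^esub> g)"
    and gen: "\<And>i f. f \<in> carrier (free_algebra n) \<Longrightarrow> Q f \<Longrightarrow> i \<in> {1..n} \<Longrightarrow>
                Q (free_gen i \<otimes>\<^bsub>free_algebra n\<^esub> f)"
  shows "Q (f :: nat list \<Rightarrow> 'k::field)"
proof -
  interpret F: ring "free_algebra n :: (nat list \<Rightarrow> 'k) ring" by (rule free_algebra_ring)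
  let ?word = "\<lambda>w u. if u = w then (1::'k) else 0"
  have word: "?word w \<in> carrier (free_algebra n) \<and> Q (?word w)" if "set w \<subseteq> {1..n}" for w
    using that
  proof (induction w)
    case Nil
    have "?word [] = \<one>\<^bsub>free_algebra n\<^esub>" by (simp add: free_algebra_def)
    then show ?case using one F.one_closed by metis
  next
    case (Cons i w)
    then have "i \<in> {1..n}" "?word w \<in> carrier (free_algebra n)" "Q (?word w)" by auto
    then show ?case
      using gen free_mult_closed free_gen_closed unfolding free_gen_mult_word[where i = i and n = n and w = w, symmetric] by blast
  qed
  have "finite {w. f w \<noteq> 0}" using f by (simp add: free_algebra_def)
  then show ?thesis using f
  proof (induction "{w. f w \<noteq> 0}" arbitrary: f rule: finite_induct)
    case empty
    \<comment> \<open>Zero is obtained from the cases \<open>const\<close> and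
      \<open>one\<close>.\<close>
    then have "f = free_const 0 \<otimes>\<^bsub>free_algebra n\<^esub> \<one>\<^bsub>free_algebra n\<^esub>"
      by (auto simp: free_const_mult)
    then show ?case using const one F.one_closed by metis
  next
    case (insert w S)
    define g where "g = f(w := 0)"
    have S: "S = {u. g u \<noteq> 0}" using insert.hyps by (auto simp: g_def)
    then have g: "g \<in> carrier (free_algebra n)"
      using insert.hyps(1) insert.prems by (auto simp: g_def free_algebra_def)
    have w: "set w \<subseteq> {1..n}" using insert.hyps(4) insert.prems by (auto simp: free_algebra_def)
    have "f = g \<oplus>\<^bsub>free_algebra n\<^esub> (free_const (f w) \<otimes>\<^bsub>free_algebra n\<^esub> ?word w)"
      unfolding free_const_mult by (auto simp: free_algebra_def g_def)
    then show ?case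
      using add[OF g] insert.hyps(3)[OF S g] word[OF w] const free_mult_closed free_const_closed by metis
  qed
qed

theorem proposition2p19:
  fixes q :: "'k :: alg_closed_field" and n :: nat
    and P :: "(nat list \<Rightarrow> 'k) set set"
  assumes "n \<ge> 1"
    and "q \<noteq> 0"
    and "\<not> (\<exists>m::nat. m \<ge> 1 \<and> q ^ m = 1)"
    and "nc_prime_ideal P (L_algebra n q)"
  shows "completely_prime_ideal P (L_algebra n q)"
proof -
  define F where "F = (free_algebra n :: (nat list \<Rightarrow> 'k) ring)"
  define I where "I = Idl\<^bsub>F\<^esub> (L_relators n q)"
  define A where "A = F Quot I"
  define R where "R = A Quot P"
  have A: "A = L_algebra n q" by (simp add: A_def I_def F_def L_algebra_def)
  interpret F: ring F unfolding F_def by (rule free_algebra_ring)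
  interpret I: ideal I F
    unfolding I_def by (intro F.genideal_ideal) (simp add: F_def L_relators_closed)
  interpret A: ring A unfolding A_def by (rule I.quotient_is_ring)
  interpret P: ideal P A using assms(4) by (simp add: A nc_prime_ideal_def)
  interpret R: ring R unfolding R_def by (rule P.quotient_is_ring)
  \<comment> \<open>The composite of the quotient maps from the free algebra to L and on to L modulo
    P.\<close>
  define \<psi> where "\<psi> f = P +>\<^bsub>A\<^esub> (I +>\<^bsub>F\<^esub> f)" for f
  interpret \<psi>: ring_hom_ring F R \<psi>
  proof
    have "(\<lambda>f. P +>\<^bsub>A\<^esub> (I +>\<^bsub>F\<^esub> f)) = (+>\<^bsub>A\<^esub>) P \<circ> (+>\<^bsub>F\<^esub>) I" by auto
    then show "\<psi> \<in> ring_hom F R"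
      unfolding \<psi>_def using ring_hom_trans[OF I.rcos_ring_hom P.rcos_ring_hom[unfolded A_def]]
      by (simp add: R_def A_def)
  qed
  have carrier_A: "carrier A = (+>\<^bsub>F\<^esub>) I ` carrier F"
    unfolding A_def by (rule carrier_FactRing)
  have carrier_R: "carrier R = (+>\<^bsub>A\<^esub>) P ` carrier A"
    unfolding R_def by (rule carrier_FactRing)
  have surj: "carrier R = \<psi> ` carrier F"
    by (auto simp: carrier_A carrier_R \<psi>_def)
  have \<psi>_eq: "\<psi> f = \<psi> g" if "f \<in> carrier F" "g \<in> carrier F" "f \<ominus>\<^bsub>F\<^esub> g \<in> I" for f g
  proof -
    have "\<psi> (f \<ominus>\<^bsub>F\<^esub> g) = \<zero>\<^bsub>R\<^esub>"
    proof -
      have "I +>\<^bsub>F\<^esub> (f \<ominus>\<^bsub>F\<^esub> g) = \<zero>\<^bsub>A\<^esub>"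
        using that I.rcos_eq_zero_iff by (simp add: A_def)
      then show ?thesis
        unfolding \<psi>_def R_def using P.rcos_eq_zero_iff[of "\<zero>\<^bsub>A\<^esub>"] by simp
    qed
    then have "\<psi> f \<ominus>\<^bsub>R\<^esub> \<psi> g = \<zero>\<^bsub>R\<^esub>" using that by (simp add: a_minus_def)
    then show ?thesis using that(1,2) by simp
  qed
  have relator: "f \<in> L_relators n q \<Longrightarrow> f \<in> I" for f
    unfolding I_def using F.genideal_self[of "L_relators n q"] L_relators_closed[of n q]
    by (auto simp: F_def)
  \<comment> \<open>The images of the constants are central and provide the scalar action on the
    quotient.\<close>
  define \<kappa> where "\<kappa> c = \<psi> (free_const c)" for c
  define sm where "sm c r = \<kappa> c \<otimes>\<^bsub>R\<^esub> r" for c r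
  have const_closed: "free_const c \<in> carrier F" for c by (simp add: F_def free_const_closed)
  have \<kappa>: "\<kappa> c \<in> carrier R" for c using const_closed by (simp add: \<kappa>_def)
  have \<kappa>_comm: "r \<otimes>\<^bsub>R\<^esub> \<kappa> c = \<kappa> c \<otimes>\<^bsub>R\<^esub> r" if r: "r \<in> carrier R" for c r
  proof -
    obtain f where f: "f \<in> carrier F" "r = \<psi> f" using r surj by auto
    have "free_const c \<otimes>\<^bsub>F\<^esub> f = f \<otimes>\<^bsub>F\<^esub> free_const c"
      by (simp add: F_def free_const_mult)
    then show ?thesis using f const_closed unfolding \<kappa>_def by (metis \<psi>.hom_mult)
  qed
  have \<kappa>_mult: "\<kappa> (c * d) = \<kappa> c \<otimes>\<^bsub>R\<^esub> \<kappa> d" for c d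
  proof -
    have "free_const (c * d) = free_const c \<otimes>\<^bsub>F\<^esub> free_const d"
      unfolding F_def free_const_mult by (auto simp: free_const_def)
    then show ?thesis using const_closed by (simp add: \<kappa>_def)
  qed
  have \<kappa>_add: "\<kappa> (c + d) = \<kappa> c \<oplus>\<^bsub>R\<^esub> \<kappa> d" for c d
  proof -
    have "free_const (c + d) = free_const c \<oplus>\<^bsub>F\<^esub> free_const d"
      unfolding F_def by (auto simp: free_algebra_def free_const_def)
    then show ?thesis using const_closed by (simp add: \<kappa>_def)
  qed
  have \<kappa>_one: "\<kappa> 1 = \<one>\<^bsub>R\<^esub>" 
    using \<psi>.hom_one unfolding \<kappa>_def F_def free_const_one[of n] .
  interpret nc_algebra R sm
  proof
    fix c d r s assume r: "r \<in> carrier R"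
    show "sm c r \<in> carrier R" "sm (c + d) r = sm c r \<oplus>\<^bsub>R\<^esub> sm d r"
      "sm c (sm d r) = sm (c * d) r" "sm 1 r = r"
      using r \<kappa> by (auto simp: sm_def \<kappa>_add \<kappa>_mult \<kappa>_one R.l_distr R.m_assoc)
    assume s: "s \<in> carrier R"
    show "sm c (r \<oplus>\<^bsub>R\<^esub> s) = sm c r \<oplus>\<^bsub>R\<^esub> sm c s"
      "sm c r \<otimes>\<^bsub>R\<^esub> s = sm c (r \<otimes>\<^bsub>R\<^esub> s)"
      using r s \<kappa> by (auto simp: sm_def R.r_distr R.m_assoc)
    show "r \<otimes>\<^bsub>R\<^esub> sm c s = sm c (r \<otimes>\<^bsub>R\<^esub> s)"
      using r s \<kappa> \<kappa>_comm[OF r, of c] by (simp add: sm_def flip: R.m_assoc)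
  qed
  define x where "x i = \<psi> (free_gen i)" for i
  have gen_closed: "free_gen i \<in> carrier F" if "1 \<le> i" "i \<le> n" for i
    using that by (simp add: F_def free_gen_closed)
  have x: "x i \<in> carrier R" if "1 \<le> i" "i \<le> n" for i
    using gen_closed that by (simp add: x_def)
  \<comment> \<open>The generators in reverse order, padded by zero because \<open>t_closed\<close>
    ranges over all indices.\<close>
  define t where "t i = (if 1 \<le> i \<and> i \<le> n then x (Suc n - i) else \<zero>\<^bsub>R\<^esub>)" for i
  have x_rel: "x i \<otimes>\<^bsub>R\<^esub> x j = sm c (x j \<otimes>\<^bsub>R\<^esub> x i)"
    if "free_gen i \<otimes>\<^bsub>F\<^esub> free_gen j \<ominus>\<^bsub>F\<^esub> free_const c \<otimes>\<^bsub>F\<^esub> (free_gen j \<otimes>\<^bsub>F\<^esub> free_gen i) \<in> I"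
      "1 \<le> i" "i \<le> n" "1 \<le> j" "j \<le> n" for i j c
    using \<psi>_eq[OF _ _ that(1)] gen_closed that(2-) const_closed by (simp add: x_def sm_def \<kappa>_def)
  interpret L_relations R sm n q t
  proof
    show "q \<noteq> 0" by (fact assms(2))
    show "t i \<in> carrier R" for i using x[of "Suc n - i"] by (auto simp: t_def)
  next
    fix i assume i: "1 \<le> i" "i < n"
    \<comment> \<open>Under the reversal t_{i+1} = x_a and t_i = x_{a+1}, so the order in the
      adjacent relation fits.\<close>
    define a where "a = n - i"
    have a: "1 \<le> a" "a + 1 \<le> n" "t (Suc i) = x a" "t i = x (a + 1)"
      using i by (auto simp: a_def t_def Suc_diff_le)
    let ?f = "free_gen a \<otimes>\<^bsub>F\<^esub> free_gen (a + 1)" and ?g = "free_gen (a + 1) \<otimes>\<^bsub>F\<^esub> free_gen a"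
    have closed: "free_gen a \<in> carrier F" "free_gen (a + 1) \<in> carrier F" using gen_closed a by auto
    have "(?f \<ominus>\<^bsub>F\<^esub> free_const q \<otimes>\<^bsub>F\<^esub> ?g) \<ominus>\<^bsub>F\<^esub> free_const (1 - q) \<in> I"
      by (rule relator) (use a in \<open>auto simp: L_relators_def F_def\<close>)
    then have "\<psi> (?f \<ominus>\<^bsub>F\<^esub> free_const q \<otimes>\<^bsub>F\<^esub> ?g) = \<psi> (free_const (1 - q))"
      by (intro \<psi>_eq) (use closed const_closed in auto)
    then have *: "x a \<otimes>\<^bsub>R\<^esub> x (a + 1) \<ominus>\<^bsub>R\<^esub> sm q (x (a + 1) \<otimes>\<^bsub>R\<^esub> x a) = \<kappa> (1 - q)"
      using closed const_closed by (simp add: a_minus_def x_def sm_def \<kappa>_def)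
    have "x a \<otimes>\<^bsub>R\<^esub> x (a + 1) = sm q (x (a + 1) \<otimes>\<^bsub>R\<^esub> x a) \<oplus>\<^bsub>R\<^esub>
         (x a \<otimes>\<^bsub>R\<^esub> x (a + 1) \<ominus>\<^bsub>R\<^esub> sm q (x (a + 1) \<otimes>\<^bsub>R\<^esub> x a))"
      using x a by (simp add: a_minus_def R.a_lcomm R.r_neg)
    then show "t (Suc i) \<otimes>\<^bsub>R\<^esub> t i = sm q (t i \<otimes>\<^bsub>R\<^esub> t (Suc i)) \<oplus>\<^bsub>R\<^esub> sm (1 - q) \<one>\<^bsub>R\<^esub>"
      using \<kappa>[of "1 - q"] unfolding * a(3,4) by (simp add: sm_def)
  next
    fix i j assume ij: "1 \<le> i" "Suc i < j" "j \<le> n"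
    define a b where "a = Suc n - j" and "b = Suc n - i"
    have ab: "1 \<le> a" "a + 1 < b" "b \<le> n" "t j = x a" "t i = x b" "b - a = j - i"
      using ij by (auto simp: a_def b_def t_def)
    \<comment> \<open>Reversal preserves distances, and j - i has the parity of i + j.\<close>
    have par: "even (b - a) \<longleftrightarrow> even (i + j)" using ij ab(6) by (auto simp: even_diff_nat)
    show "qcomm (if even (i + j) then inverse q else q) (t j) (t i)"
      unfolding qcomm_def ab(4,5)
    proof (rule x_rel[OF relator])
      show "free_gen a \<otimes>\<^bsub>F\<^esub> free_gen b \<ominus>\<^bsub>F\<^esub> free_const (if even (i + j) then inverse q else q)
         \<otimes>\<^bsub>F\<^esub> (free_gen b \<otimes>\<^bsub>F\<^esub> free_gen a) \<in> L_relators n q"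
        unfolding L_relators_def F_def using ab(1-3) par by (cases "even (i + j)") auto
    qed (use ab in auto)
  qed
  have psi_subalg: "\<psi> f \<in> subalg n" if "f \<in> carrier F" for f
    using that unfolding F_def
  proof (induction rule: free_algebra_induct)
    case one
    show ?case using subalg.one by (simp add: F_def[symmetric])
  next
    case (const c f)
    then have "\<psi> (free_const c \<otimes>\<^bsub>F\<^esub> f) = sm c (\<psi> f)"
      using const_closed by (simp add: F_def[symmetric] sm_def \<kappa>_def)
    then show ?case using const subalg.sm by (simp add: F_def[symmetric])
  next
    case (add f g)
    then show ?case using subalg.add by (simp add: F_def[symmetric])
  next
    case (gen i f)
    then have "t (Suc n - i) = x i" by (auto simp: t_def)
    then have "\<psi> (free_gen i \<otimes>\<^bsub>F\<^esub> f) = t (Suc n - i) \<otimes>\<^bsub>R\<^esub> \<psi> f"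
      using gen gen_closed by (simp add: F_def[symmetric] x_def)
    moreover have "1 \<le> Suc n - i" "Suc n - i \<le> n" using \<open>i \<in> {1..n}\<close> by auto
    ultimately show ?case using gen subalg.gen[of "\<psi> f" n "Suc n - i"] by (simp add: F_def[symmetric])
  qed
  interpret prime_L_relations R sm n q t
  proof
    show "q ^ m \<noteq> 1" if "m \<ge> 1" for m using assms(3) that by blast
    show "carrier R \<subseteq> subalg n" using psi_subalg surj by auto
    \<comment> \<open>A prime ideal is proper, so the quotient is nontrivial.\<close>
    show "\<one>\<^bsub>R\<^esub> \<noteq> \<zero>\<^bsub>R\<^esub>"
    proof
      assume "\<one>\<^bsub>R\<^esub> = \<zero>\<^bsub>R\<^esub>"
      then have "P +>\<^bsub>A\<^esub> \<one>\<^bsub>A\<^esub> = \<zero>\<^bsub>R\<^esub>"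
        using ring_hom_one[OF P.rcos_ring_hom] by (simp add: R_def)
      then have "P = carrier A"
        using P.rcos_eq_zero_iff P.one_imp_carrier by (simp add: R_def)
      then show False using assms(4) by (simp add: nc_prime_ideal_def A)
    qed
  next
    fix a b assume ab: "a \<in> carrier R" "b \<in> carrier R"
      "\<And>r. r \<in> carrier R \<Longrightarrow> a \<otimes>\<^bsub>R\<^esub> (r \<otimes>\<^bsub>R\<^esub> b) = \<zero>\<^bsub>R\<^esub>"
    then obtain a' b' where *: "a' \<in> carrier A" "a = P +>\<^bsub>A\<^esub> a'" "b' \<in> carrier A" "b = P +>\<^bsub>A\<^esub> b'"
      by (auto simp: carrier_R)
    have "a' \<in> P \<or> b' \<in> P"
    proof (rule A.nc_prime_ideal_elementwise)
      show "nc_prime_ideal P A" using assms(4) by (simp add: A)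
      fix r assume r: "r \<in> carrier A"
      have "P +>\<^bsub>A\<^esub> (a' \<otimes>\<^bsub>A\<^esub> (r \<otimes>\<^bsub>A\<^esub> b')) = a \<otimes>\<^bsub>R\<^esub> ((P +>\<^bsub>A\<^esub> r) \<otimes>\<^bsub>R\<^esub> b)"
        using P.rcos_ring_hom r * by (simp add: R_def ring_hom_mult)
      also have "\<dots> = \<zero>\<^bsub>R\<^esub>" using ab r by (simp add: carrier_R)
      finally show "a' \<otimes>\<^bsub>A\<^esub> (r \<otimes>\<^bsub>A\<^esub> b') \<in> P"
        using P.rcos_eq_zero_iff r * by (simp add: R_def)
    qed (use * in auto)
    then show "a = \<zero>\<^bsub>R\<^esub> \<or> b = \<zero>\<^bsub>R\<^esub>"
      using P.rcos_eq_zero_iff * by (auto simp: R_def)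
  qed
  have "nc_domain R"
    unfolding nc_domain_def using R.ring_axioms nontrivial no_zero_divisors by blast
  then show ?thesis
    unfolding completely_prime_ideal_def using P.ideal_axioms by (simp add: R_def A)
qed

end
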